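(* Let $(A,\widetilde{A})$ be a dual pair of closed operators on a Hilbert space $\mathcal{H}$ having the common core property, where $A$ is dissipative, let $\mathcal{D}\subset\mathcal{D}(A)\cap\mathcal{D}(\widetilde{A})$ be a common core for $A$ and $\widetilde{A}$, let $V:=\frac{A-\widetilde{A}}{2i}$ with domain $\mathcal{D}$ (a non-negative symmetric operator), and let $V_K$ be its Kreĭn–von Neumann extension. Let $\mathcal{V}$ be a subspace of $\mathcal{D}(\widetilde{A}^* )//\mathcal{D}(A)$ such that $A_\mathcal{V}$ is a proper dissipative extension of the dual pair $(A,\widetilde{A})$ and, for $v\in\mathcal{V}$, let $q(v):=\operatorname{Im}\langle v,\widetilde{A}^*v\rangle-\|V_K^{1/2}v\|^2$. Then $$\operatorname{Im}\langle f+v,A_\mathcal{V}(f+v)\rangle=\|V_K^{1/2}(f+v)\|^2+q(v)\ \ge\ \|V_K^{1/2}(f+v)\|^2\quad\text{for all } f\in\mathcal{D}(A),\ v\in\mathcal{V}.$$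
   Context: The inner product $\langle\cdot,\cdot\rangle$ of the Hilbert space $\mathcal{H}$ is antilinear in the first and linear in the second argument. Dissipative: an operator $A$ is dissipative if it is densely defined and $\operatorname{Im}\langle f,Af\rangle\ge 0$ for all $f\in\mathcal{D}(A)$. Dual pair: a pair $(A,\widetilde{A})$ of densely defined closable operators with $A\subset\widetilde{A}^*$ (equivalently $\widetilde{A}\subset A^*$). A proper extension of $(A,\widetilde A)$ is an operator $A'$ with $A\subset A'\subset\widetilde{A}^*$. Common core property: a dual pair $(A,\widetilde A)$ of closed operators has the common core property if $A=\overline{A\upharpoonright_{\mathcal{D}(A)\cap\mathcal{D}(\widetilde{A})}}$ and $\widetilde{A}=\overline{\widetilde{A}\upharpoonright_{\mathcal{D}(A)\cap\mathcal{D}(\widetilde{A})}}$. A subspace $\mathcal{D}\subset\mathcal{D}(A)\cap\mathcal{D}(\widetilde A)$ is a common core if $A=\overline{A\upharpoonright_{\mathcal{D}}}$ and $\widetilde{A}=\overline{\widetilde{A}\upharpoonright_{\mathcal{D}}}$. Complementary subspaces: for linear spaces $\mathcal{M}\subset\mathcal{N}$ (not necessarily closed), $\mathcal{N}//\mathcal{M}$ denotes any (fixed) subspace of $\mathcal{N}$ with $(\mathcal{N}//\mathcal{M})+\mathcal{M}=\mathcal{N}$ and $(\mathcal{N}//\mathcal{M})\cap\mathcal{M}=\{0\}$. For a subspace $\mathcal{V}\subset\mathcal{D}(\widetilde{A}^* )//\mathcal{D}(A)$, the operator $A_\mathcal{V}$ is defined by $\mathcal{D}(A_\mathcal{V})=\mathcal{D}(A)\dot{+}\mathcal{V}$,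 $A_\mathcal{V}=\widetilde{A}^*\upharpoonright_{\mathcal{D}(A_\mathcal{V})}$. (If $A_\mathcal{V}$ is dissipative then $\mathcal{V}\subset\mathcal{D}(V_K^{1/2})$, so $q$ is well defined.) Kreĭn–von Neumann extension: for a densely defined non-negative symmetric operator $V$, $V_K$ denotes its smallest non-negative selfadjoint extension, i.e. $0\le V_K\le\widehat V$ for every non-negative selfadjoint extension $\widehat V$ of $V$ (it exists and is unique). Here, for non-negative selfadjoint $B,C$, $B\le C$ means $\mathcal{D}(B^{1/2})\supset\mathcal{D}(C^{1/2})$ and $\|B^{1/2}f\|\le\|C^{1/2}f\|$ for all $f\in\mathcal{D}(C^{1/2})$. *)

theory Defs
  imports "HOL-Analysis.Analysis"
begin

section \<open>Complex Hilbert spaces\<close>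

text \<open>
  The complex structure sits on top of a complete real inner product space, whose norm, metric and
  topology are reused. Definiteness of the complex inner product and
  \<open>norm x ^ 2 = cinner x x\<close> follow from \<open>inner_eq_Re_cinner\<close> and conjugate symmetry.
\<close>

class chilbert_space = real_inner + complete_space +
  fixes scaleC :: "complex \<Rightarrow> 'a \<Rightarrow> 'a"  (infixr \<open>*\<^sub>C\<close> 75)
    and cinner :: "'a \<Rightarrow> 'a \<Rightarrow> complex"
  assumes scaleC_add_right: "a *\<^sub>C (x + y) = a *\<^sub>C x + a *\<^sub>C y"
    and scaleC_add_left: "(a + b) *\<^sub>C x = a *\<^sub>C x + b *\<^sub>C x"
    and scaleC_scaleC: "a *\<^sub>C (b *\<^sub>C x) = (a * b) *\<^sub>C x"
    and scaleC_of_real: "complex_of_real r *\<^sub>C x = r *\<^sub>R x"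
    and cinner_commute: "cinner x y = cnj (cinner y x)"
    and cinner_add_right: "cinner x (y + z) = cinner x y + cinner x z"
    and cinner_scaleC_right: "cinner x (a *\<^sub>C y) = a * cinner x y"
    and inner_eq_Re_cinner: "inner x y = Re (cinner x y)"

global_interpretation complex_vector: vector_space "scaleC :: complex \<Rightarrow> 'a \<Rightarrow> 'a::chilbert_space"
  defines csubspace = complex_vector.subspace
proof
  show "1 *\<^sub>C x = x" for x :: 'a
    using scaleC_of_real[of 1 x] by simp
qed (simp_all add: scaleC_add_right scaleC_add_left scaleC_scaleC)

instantiation complex :: chilbert_space
begin

definition "scaleC_complex (a::complex) (x::complex) = a * x"
definition "cinner_complex (x::complex) (y::complex) = cnj x * y"

instance
  by standard (simp_all add: scaleC_complex_def cinner_complex_def inner_complex_def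
      algebra_simps scaleR_conv_of_real)

end

instantiation prod :: (chilbert_space, chilbert_space) chilbert_space
begin

definition "scaleC_prod a x = (a *\<^sub>C fst x, a *\<^sub>C snd x)"
definition "cinner_prod x y = cinner (fst x) (fst y) + cinner (snd x) (snd y)"

instance
proof
  fix x y :: "'a \<times> 'b"
  show "cinner x y = cnj (cinner y x)"
    unfolding cinner_prod_def by (metis cinner_commute complex_cnj_add)
qed (simp_all add: scaleC_prod_def cinner_prod_def inner_prod_def prod_eq_iff scaleC_add_right
      scaleC_add_left scaleC_scaleC scaleC_of_real cinner_add_right cinner_scaleC_right
      inner_eq_Re_cinner algebra_simps)

end

section \<open>Unbounded operators\<close>

text \<open>
  A (possibly unbounded) operator is identified with its graph. Thus its domain is \<open>Domain T\<close>,
  \<open>B\<close> extends \<open>A\<close> iff \<open>A \<subseteq> B\<close>, the closure of a closable operator is the topological closure of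
  its graph, and the product of an operator with itself is the relational composition \<open>T O T\<close>.
\<close>

type_synonym 'h op = "('h \<times> 'h) set"

definition is_operator :: "'h::chilbert_space op \<Rightarrow> bool" where
  "is_operator T \<longleftrightarrow> csubspace T \<and> single_valued T"

definition op_apply :: "'h::chilbert_space op \<Rightarrow> 'h \<Rightarrow> 'h"  (infixl \<open>\<cdot>\<close> 78) where
  "T \<cdot> x = (THE y. (x, y) \<in> T)"

definition op_restrict :: "'h::chilbert_space op \<Rightarrow> 'h set \<Rightarrow> 'h op" where
  "op_restrict T S = {(x, y) \<in> T. x \<in> S}"

definition densely_defined :: "'h::chilbert_space op \<Rightarrow> bool" where
  "densely_defined T \<longleftrightarrow> is_operator T \<and> closure (Domain T) = UNIV"

definition closed_operator :: "'h::chilbert_space op \<Rightarrow> bool" where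
  "closed_operator T \<longleftrightarrow> is_operator T \<and> closed T"

definition closable :: "'h::chilbert_space op \<Rightarrow> bool" where
  "closable T \<longleftrightarrow> is_operator T \<and> is_operator (closure T)"

text \<open>This relation is the graph of the adjoint whenever \<open>T\<close> is densely defined.\<close>

definition adjoint_op :: "'h::chilbert_space op \<Rightarrow> 'h op" where
  "adjoint_op T = {(g, h). \<forall>(x, y) \<in> T. cinner g y = cinner h x}"

definition dissipative :: "'h::chilbert_space op \<Rightarrow> bool" where
  "dissipative T \<longleftrightarrow> densely_defined T \<and> (\<forall>f \<in> Domain T. 0 \<le> Im (cinner f (T \<cdot> f)))"

definition nonneg_selfadjoint :: "'h::chilbert_space op \<Rightarrow> bool" where
  "nonneg_selfadjoint T \<longleftrightarrow> densely_defined T \<and> adjoint_op T = T \<and>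
     (\<forall>f \<in> Domain T. cinner f (T \<cdot> f) \<in> \<real>\<^sub>\<ge>\<^sub>0)"

text \<open>The non-negative square root exists and is unique for non-negative selfadjoint \<open>B\<close>, so that
  the choice is immaterial there.\<close>

definition op_sqrt :: "'h::chilbert_space op \<Rightarrow> 'h op" where
  "op_sqrt B = (SOME S. nonneg_selfadjoint S \<and> S O S = B)"

text \<open>The order of non-negative selfadjoint operators in the sense of quadratic forms.\<close>

definition op_le :: "'h::chilbert_space op \<Rightarrow> 'h op \<Rightarrow> bool" where
  "op_le B C \<longleftrightarrow> Domain (op_sqrt C) \<subseteq> Domain (op_sqrt B) \<and>
     (\<forall>f \<in> Domain (op_sqrt C). norm (op_sqrt B \<cdot> f) \<le> norm (op_sqrt C \<cdot> f))"

text \<open>The smallest non-negative selfadjoint extension of a densely defined non-negative symmetric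
  operator; again it exists and is unique, so that the choice is immaterial there.\<close>

definition krein_von_neumann :: "'h::chilbert_space op \<Rightarrow> 'h op" where
  "krein_von_neumann V = (SOME K. nonneg_selfadjoint K \<and> V \<subseteq> K \<and>
     (\<forall>V'. nonneg_selfadjoint V' \<and> V \<subseteq> V' \<longrightarrow> op_le K V'))"

section \<open>Dual pairs\<close>

definition dual_pair :: "'h::chilbert_space op \<Rightarrow> 'h op \<Rightarrow> bool" where
  "dual_pair A At \<longleftrightarrow> densely_defined A \<and> closable A \<and> densely_defined At \<and> closable At \<and>
     A \<subseteq> adjoint_op At"

definition proper_extension :: "'h::chilbert_space op \<Rightarrow> 'h op \<Rightarrow> 'h op \<Rightarrow> bool" where
  "proper_extension A At A' \<longleftrightarrow> is_operator A' \<and> A \<subseteq> A' \<and> A' \<subseteq> adjoint_op At"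

definition common_core :: "'h::chilbert_space op \<Rightarrow> 'h op \<Rightarrow> 'h set \<Rightarrow> bool" where
  "common_core A At D \<longleftrightarrow> csubspace D \<and> D \<subseteq> Domain A \<inter> Domain At \<and>
     A = closure (op_restrict A D) \<and> At = closure (op_restrict At D)"

definition common_core_property :: "'h::chilbert_space op \<Rightarrow> 'h op \<Rightarrow> bool" where
  "common_core_property A At \<longleftrightarrow>
     A = closure (op_restrict A (Domain A \<inter> Domain At)) \<and>
     At = closure (op_restrict At (Domain A \<inter> Domain At))"

text \<open>\<open>is_complement N M W\<close>: the subspace \<open>W\<close> is a possible choice of \<open>N // M\<close>.\<close>

definition is_complement :: "'h::chilbert_space set \<Rightarrow> 'h set \<Rightarrow> 'h set \<Rightarrow> bool" where
  "is_complement N M W \<longleftrightarrow> csubspace W \<and> {w + m | w m. w \<in> W \<and> m \<in> M} = N \<and> W \<inter> M = {0}"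

definition imaginary_part_on :: "'h::chilbert_space op \<Rightarrow> 'h op \<Rightarrow> 'h set \<Rightarrow> 'h op" where
  "imaginary_part_on A At D = {(f, (1 / (2 * \<i>)) *\<^sub>C (A \<cdot> f - At \<cdot> f)) | f. f \<in> D}"

definition ext_by :: "'h::chilbert_space op \<Rightarrow> 'h op \<Rightarrow> 'h set \<Rightarrow> 'h op" where
  "ext_by A At W = op_restrict (adjoint_op At) {f + v | f v. f \<in> Domain A \<and> v \<in> W}"

end

theory Submission
  imports Defs
begin

text \<open>
  Dissipativity of \<open>A\<^sub>V\<close> says that \<open>inner f (V f) + 2 * inner v (V f) + Im (cinner v (A\<^sub>V v))\<close>
  is non-negative for all \<open>f\<close> in the common core. Hence
  \<open>(inner v (V f))\<^sup>2 \<le> Im (cinner v (A\<^sub>V v)) * inner f (V f)\<close>, and by the Ando--Nishio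
  characterisation of the form of the Krein--von Neumann extension \<open>K\<close> this means that \<open>v\<close> lies in
  the domain of \<open>K\<^sup>1\<^sup>/\<^sup>2\<close> with \<open>(norm (K\<^sup>1\<^sup>/\<^sup>2 v))\<^sup>2 \<le> Im (cinner v (A\<^sub>V v))\<close>, that is, \<open>q v \<ge> 0\<close>.
  The identity follows on the core by completing the square and extends to the domain of \<open>A\<close>
  because \<open>K\<^sup>1\<^sup>/\<^sup>2\<close> is closed.

  No spectral theorem is used: the graph of \<open>K\<close> is written down as a closure, its resolvent is
  found by minimising a quadratic functional, and the square root of an unbounded operator is
  built from the square roots of two bounded ones.
\<close>

section \<open>Semidefinite quadratic forms and minimising sequences\<close>

instance chilbert_space \<subseteq> banach ..

text \<open>A quadratic that never becomes negative has no two distinct real roots. Besides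
  Cauchy-Schwarz this yields the convergence rate in \<open>form_riesz\<close> and the form bound
  extracted from dissipativity.\<close>

lemma discriminant_bound:
  fixes a d e :: real
  assumes nonneg: "\<And>t. 0 \<le> e + 2 * t * d + t\<^sup>2 * a" and "0 \<le> a"
  shows "d\<^sup>2 \<le> e * a"
proof (cases "a = 0")
  case True
  have "d = 0"
  proof (rule ccontr)
    assume "d \<noteq> 0"
    then show False
      \<comment> \<open>At this \<open>t\<close> the affine function e + 2 t d has the value
        -1.\<close>
      using nonneg[of "- (e + 1) / (2 * d)"] True by (simp add: field_simps)
  qed
  then show ?thesis
    using True by simp
next
  case False
  then have "a > 0"
    using \<open>0 \<le> a\<close> by simp
  then show ?thesis
    using nonneg[of "- d / a"] by (simp add: field_simps power2_eq_square)
qed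

text \<open>Symmetry and positivity are asked for on \<open>D\<close> only, since the form used
  later is symmetric on the graph of an operator but not on the whole product space.\<close>

lemma form_cauchy_schwarz:
  fixes m :: "'v::real_vector \<Rightarrow> 'v \<Rightarrow> real"
  assumes m: "bilinear m" and D: "subspace D"
    and sym: "\<And>f g. f \<in> D \<Longrightarrow> g \<in> D \<Longrightarrow> m f g = m g f"
    and pos: "\<And>f. f \<in> D \<Longrightarrow> 0 \<le> m f f"
    and f: "f \<in> D" and g: "g \<in> D"
  shows "(m f g)\<^sup>2 \<le> m f f * m g g"
proof (rule discriminant_bound)
  fix t :: real
  have "0 \<le> m (f + t *\<^sub>R g) (f + t *\<^sub>R g)"
    using D f g by (intro pos subspace_add subspace_scale)
  also have "\<dots> = m f f + 2 * t * m f g + t\<^sup>2 * m g g"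
    using sym[OF f g]
    by (simp add: bilinear_ladd[OF m] bilinear_radd[OF m] bilinear_lmul[OF m] bilinear_rmul[OF m]
        power2_eq_square algebra_simps)
  finally show "0 \<le> m f f + 2 * t * m f g + t\<^sup>2 * m g g" .
qed (rule pos[OF g])

text \<open>The Riesz representation theorem in the completion of \<open>D\<close> with respect to the seminorm
  of \<open>m\<close>: the representing element is given by a minimising sequence of \<open>m f f - 2 * l f\<close>.\<close>

lemma form_riesz:
  fixes m :: "'v::real_vector \<Rightarrow> 'v \<Rightarrow> real"
  assumes m: "bilinear m" and D: "subspace D"
    and sym: "\<And>f g. f \<in> D \<Longrightarrow> g \<in> D \<Longrightarrow> m f g = m g f"
    and pos: "\<And>f. f \<in> D \<Longrightarrow> 0 \<le> m f f"
    and l: "linear l" and bound: "\<And>f. f \<in> D \<Longrightarrow> (l f)\<^sup>2 \<le> C * m f f"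
  shows "\<exists>F e. (\<forall>n. F n \<in> D) \<and> e \<longlonglongrightarrow> 0 \<and>
    (\<forall>i j. m (F i - F j) (F i - F j) \<le> e i + e j) \<and> (\<forall>g\<in>D. (\<lambda>n. m (F n) g) \<longlonglongrightarrow> l g)"
proof -
  define \<Phi> where "\<Phi> f = m f f - 2 * l f" for f
  note bil = bilinear_ladd[OF m] bilinear_radd[OF m] bilinear_lmul[OF m] bilinear_rmul[OF m]
    bilinear_lsub[OF m] bilinear_rsub[OF m] linear_add[OF l] linear_scale[OF l]
  \<comment> \<open>Boundedness below: by the arithmetic-geometric mean inequality
    \<open>l f\<close> is at most (|C| + m f f) / 2. The absolute value appears because
    \<open>C\<close> has no prescribed sign.\<close>
  have "- \<bar>C\<bar> \<le> \<Phi> f" if "f \<in> D" for f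
  proof -
    have "(l f)\<^sup>2 \<le> \<bar>C\<bar> * m f f"
      using bound[OF that] pos[OF that] by (meson abs_ge_self mult_right_mono order_trans)
    also have "\<dots> \<le> ((\<bar>C\<bar> + m f f) / 2)\<^sup>2"
      using zero_le_power2[of "\<bar>C\<bar> - m f f"] by (simp add: power2_eq_square field_simps)
    finally have "l f \<le> (\<bar>C\<bar> + m f f) / 2"
      by (rule power2_le_imp_le) (use pos[OF that] in simp)
    then show ?thesis
      by (simp add: \<Phi>_def)
  qed
  then have bdd: "bdd_below (\<Phi> ` D)"
    unfolding bdd_below_def by blast
  define I where "I = Inf (\<Phi> ` D)"
  have I: "I \<le> \<Phi> f" if "f \<in> D" for f
    unfolding I_def using bdd that by (intro cInf_lower) auto
  have "\<exists>f\<in>D. \<Phi> f < I + 1 / real (Suc n)" for n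
  proof -
    have "\<Phi> ` D \<noteq> {}"
      using subspace_0[OF D] by auto
    then show ?thesis
      using cInf_lessD[of "\<Phi> ` D" "I + 1 / real (Suc n)"] unfolding I_def by auto
  qed
  then obtain F where F: "\<And>n. F n \<in> D" and \<Phi>F: "\<And>n. \<Phi> (F n) < I + 1 / real (Suc n)"
    by metis
  have conv: "(\<lambda>n. c / real (Suc n)) \<longlonglongrightarrow> 0" for c
    by (rule LIMSEQ_Suc[OF lim_const_over_n])
  show ?thesis
  proof (intro exI[of _ F] exI[of _ "\<lambda>n. 2 / real (Suc n)"] conjI allI ballI)
    show "m (F i - F j) (F i - F j) \<le> 2 / real (Suc i) + 2 / real (Suc j)" for i j
    proof -
      \<comment> \<open>Parallelogram identity: the linear parts cancel and the midpoint has energy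
        at least \<open>I\<close>, so two almost minimisers are close in the seminorm.\<close>
      have "I \<le> \<Phi> ((1 / 2) *\<^sub>R (F i + F j))"
        using D F by (intro I subspace_add subspace_scale)
      moreover have "m (F i - F j) (F i - F j) =
          2 * \<Phi> (F i) + 2 * \<Phi> (F j) - 4 * \<Phi> ((1 / 2) *\<^sub>R (F i + F j))"
        using sym[OF F F, of i j] by (simp add: \<Phi>_def bil) (simp add: field_simps)
      ultimately show ?thesis
        using \<Phi>F[of i] \<Phi>F[of j] times_divide_eq_right[of 2 1 "real (Suc i)"]
          times_divide_eq_right[of 2 1 "real (Suc j)"] by linarith
    qed
    show "(\<lambda>n. m (F n) g) \<longlonglongrightarrow> l g" if g: "g \<in> D" for g
    proof -
      \<comment> \<open>Approximate Euler equation: moving \<open>F n\<close> in the direction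
        \<open>g\<close> lowers the energy by at most 1 / (n + 1), so the discriminant controls the
        first variation.\<close>
      have le: "(m (F n) g - l g)\<^sup>2 \<le> 1 / real (Suc n) * m g g" for n
      proof (rule discriminant_bound)
        fix t :: real
        have "I \<le> \<Phi> (F n + t *\<^sub>R g)"
          using D F g by (intro I subspace_add subspace_scale)
        also have "\<dots> = \<Phi> (F n) + 2 * t * (m (F n) g - l g) + t\<^sup>2 * m g g"
          using sym[OF F g, of n] by (simp add: \<Phi>_def bil power2_eq_square algebra_simps)
        finally show "0 \<le> 1 / real (Suc n) + 2 * t * (m (F n) g - l g) + t\<^sup>2 * m g g"
          using \<Phi>F[of n] by simp
      qed (rule pos[OF g])
      have "(\<lambda>n. (m (F n) g - l g)\<^sup>2) \<longlonglongrightarrow> 0"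
        by (rule tendsto_sandwich[OF _ _ tendsto_const conv[of "m g g"]]) 
        (use le in simp_all)
      then have "(\<lambda>n. m (F n) g - l g) \<longlonglongrightarrow> 0"
        by simp
      then show ?thesis
        by (simp add: LIM_zero_iff)
    qed
  qed (use F conv in auto)
qed

text \<open>The shape e i + e j is the one that \<open>form_riesz\<close> delivers; norm convergence
  follows once the form dominates the squared norm.\<close>

lemma Cauchy_if_square_dist_le:
  fixes X :: "nat \<Rightarrow> 'a::real_normed_vector"
  assumes "e \<longlonglongrightarrow> 0" and le: "\<And>i j. (norm (X i - X j))\<^sup>2 \<le> e i + e j"
  shows "Cauchy X"
proof (rule CauchyI)
  fix r :: real
  assume "0 < r"
  then have "\<forall>\<^sub>F n in sequentially. e n < r\<^sup>2 / 2"
    using assms(1) by (intro order_tendstoD(2)) auto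
  then obtain N where N: "\<And>n. n \<ge> N \<Longrightarrow> e n < r\<^sup>2 / 2"
    unfolding eventually_sequentially by auto
  have "norm (X i - X j) < r" if "i \<ge> N" "j \<ge> N" for i j
  proof (rule power2_less_imp_less)
    show "(norm (X i - X j))\<^sup>2 < r\<^sup>2"
      using le[of i j] N[OF that(1)] N[OF that(2)] by simp
  qed (use \<open>0 < r\<close> in simp)
  then show "\<exists>M. \<forall>i\<ge>M. \<forall>j\<ge>M. norm (X i - X j) < r"
    by blast
qed

section \<open>Bounded square roots\<close>

text \<open>Fixed-point iteration for the square root: with R = 1 - Y and X = 1 - A, the equation
  R^2 = X becomes Y = (A + Y^2) / 2.\<close>

primrec sqrt_iter :: "'a::real_normed_vector \<Rightarrow>\<^sub>L 'a \<Rightarrow> nat \<Rightarrow> 'a \<Rightarrow>\<^sub>L 'a" where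
  "sqrt_iter A 0 = 0"
| "sqrt_iter A (Suc n) = (1 / 2) *\<^sub>R (A + (sqrt_iter A n o\<^sub>L sqrt_iter A n))"

text \<open>The same iteration for the number 1 in place of \<open>A\<close>; it majorises the norms
  of the iterates and of their increments.\<close>

primrec sqrt_majorant :: "nat \<Rightarrow> real" where
  "sqrt_majorant 0 = 0"
| "sqrt_majorant (Suc n) = (1 + (sqrt_majorant n)\<^sup>2) / 2"

interpretation blinfun_compose: bounded_bilinear "(o\<^sub>L)"
  by (rule bounded_bilinear_blinfun_compose)

lemma sqrt_majorant_bounds: "0 \<le> sqrt_majorant n \<and> sqrt_majorant n \<le> 1"
  by (induction n) (auto simp: power2_eq_square intro: mult_le_one)

lemma sqrt_majorant_Suc_le: "sqrt_majorant n \<le> sqrt_majorant (Suc n)"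
  using zero_le_power2[of "1 - sqrt_majorant n"] by (simp add: power2_eq_square algebra_simps)

lemma norm_sqrt_iter_le:
  assumes "norm A \<le> 1"
  shows "norm (sqrt_iter A n) \<le> sqrt_majorant n"
proof (induction n)
  case (Suc n)
  have "norm (sqrt_iter A n o\<^sub>L sqrt_iter A n) \<le> (sqrt_majorant n)\<^sup>2"
    using norm_blinfun_compose[of "sqrt_iter A n" "sqrt_iter A n"]
      mult_mono[OF Suc Suc] sqrt_majorant_bounds[of n]
    by (simp add: power2_eq_square)
  then show ?case
    using norm_triangle_ineq[of A "sqrt_iter A n o\<^sub>L sqrt_iter A n"] assms by simp
qed simp

text \<open>Every iterate is a polynomial in \<open>A\<close>. In particular the iterates commute
  with each other, and in the limit the root commutes with whatever commutes with the given
  operator.\<close>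

lemma sqrt_iter_commute:
  assumes "C o\<^sub>L A = A o\<^sub>L C"
  shows "C o\<^sub>L sqrt_iter A n = sqrt_iter A n o\<^sub>L C"
proof (induction n)
  case (Suc n)
  have "C (sqrt_iter A n x) = sqrt_iter A n (C x)" for x
    using Suc by (metis blinfun_apply_blinfun_compose)
  then have "C o\<^sub>L (sqrt_iter A n o\<^sub>L sqrt_iter A n) = (sqrt_iter A n o\<^sub>L sqrt_iter A n) o\<^sub>L C"
    by (intro blinfun_eqI) simp
  then show ?case
    using assms by (simp add: blinfun_compose.add_left blinfun_compose.add_right
        blinfun_compose.scaleR_left blinfun_compose.scaleR_right)
qed (simp add: blinfun_compose.zero_left blinfun_compose.zero_right)

text \<open>Since the iterates commute, the difference of squares factors as (Z + Y)(Z - Y), and the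
  scalar majorant factors in the same way.\<close>

lemma norm_sqrt_iter_diff_le:
  assumes A: "norm A \<le> 1"
  shows "norm (sqrt_iter A (Suc n) - sqrt_iter A n) \<le> sqrt_majorant (Suc n) - sqrt_majorant n"
proof (induction n)
  case 0
  then show ?case
    using A by (simp add: blinfun_compose.zero_left)
next
  case (Suc n)
  let ?Y = "sqrt_iter A n" and ?Z = "sqrt_iter A (Suc n)"
  let ?s = "sqrt_majorant n" and ?t = "sqrt_majorant (Suc n)"
  have YZ: "?Y o\<^sub>L ?Z = ?Z o\<^sub>L ?Y"
    by (intro sqrt_iter_commute sqrt_iter_commute[symmetric] refl)
  have "sqrt_iter A (Suc (Suc n)) - ?Z = (1 / 2) *\<^sub>R ((?Z o\<^sub>L ?Z) - (?Y o\<^sub>L ?Y))"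
    by (simp only: sqrt_iter.simps(2)[of A "Suc n"] sqrt_iter.simps(2)[of A n]
        add_diff_cancel_left flip: scaleR_diff_right)
  also have "(?Z o\<^sub>L ?Z) - (?Y o\<^sub>L ?Y) = (?Z + ?Y) o\<^sub>L (?Z - ?Y)"
    using YZ by (simp add: blinfun_compose.add_left blinfun_compose.diff_right
        del: sqrt_iter.simps)
  finally have eq: "sqrt_iter A (Suc (Suc n)) - ?Z = (1 / 2) *\<^sub>R ((?Z + ?Y) o\<^sub>L (?Z - ?Y))" .
  have "norm ((?Z + ?Y) o\<^sub>L (?Z - ?Y)) \<le> norm (?Z + ?Y) * norm (?Z - ?Y)"
    by (rule norm_blinfun_compose)
  also have "\<dots> \<le> (?t + ?s) * (?t - ?s)"
  proof (rule mult_mono)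
    show "norm (?Z + ?Y) \<le> ?t + ?s"
      by (rule norm_triangle_mono[OF norm_sqrt_iter_le[OF A] norm_sqrt_iter_le[OF A]])
    show "0 \<le> ?t + ?s"
      using sqrt_majorant_bounds[of n] sqrt_majorant_bounds[of "Suc n"] by simp
  qed (use Suc in auto)
  also have "\<dots> = 2 * (sqrt_majorant (Suc (Suc n)) - ?t)"
    unfolding sqrt_majorant.simps(2)[of "Suc n"] sqrt_majorant.simps(2)[of n]
    by (simp add: power2_eq_square field_simps)
  finally show ?case
    unfolding eq norm_scaleR by (simp del: sqrt_iter.simps sqrt_majorant.simps)
qed

text \<open>The increments are dominated by those of a bounded increasing real sequence, whose
  series telescopes. This covers the boundary case of norm 1, where a geometric series would
  fail.\<close>

lemma sqrt_iter_convergent: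
  fixes A :: "'a::banach \<Rightarrow>\<^sub>L 'a"
  assumes A: "norm A \<le> 1"
  shows "convergent (sqrt_iter A)"
proof -
  have "summable (\<lambda>n. sqrt_majorant (Suc n) - sqrt_majorant n)"
  proof -
    have "incseq sqrt_majorant"
      by (intro incseq_SucI sqrt_majorant_Suc_le)
    then have "convergent sqrt_majorant"
      using incseq_convergent[of sqrt_majorant 1] sqrt_majorant_bounds
      unfolding convergent_def by metis
    then show ?thesis
      by (rule telescope_summable[OF convergent_LIMSEQ_iff[THEN iffD1]])
  qed
  then have "summable (\<lambda>n. sqrt_iter A (Suc n) - sqrt_iter A n)"
    by (rule summable_comparison_test'[where N = 0]) (rule norm_sqrt_iter_diff_le[OF A])
  then have "convergent (\<lambda>n. \<Sum>k<n. sqrt_iter A (Suc k) - sqrt_iter A k)"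
    by (simp add: summable_iff_convergent)
  then show ?thesis
    by (simp only: sum_lessThan_telescope sqrt_iter.simps(1) diff_zero)
qed

text \<open>The limit of the iteration is 1 - R. The root inherits the norm bound and the symmetry,
  so a root can be taken again. The commutation clause later supplies complex linearity, as
  multiplication by a scalar is a bounded real-linear operator.\<close>

lemma blinfun_sqrt_exists:
  fixes X :: "'a::{real_inner,banach} \<Rightarrow>\<^sub>L 'a"
  assumes X: "norm (id_blinfun - X) \<le> 1" and sym: "\<And>x y. inner (X x) y = inner x (X y)"
  shows "\<exists>R :: 'a \<Rightarrow>\<^sub>L 'a. norm (id_blinfun - R) \<le> 1 \<and>
    (\<forall>x y. inner (R x) y = inner x (R y)) \<and> (\<forall>x. R (R x) = X x) \<and>
    (\<forall>C. C o\<^sub>L X = X o\<^sub>L C \<longrightarrow> C o\<^sub>L R = R o\<^sub>L C)"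
proof -
  let ?A = "id_blinfun - X"
  have id_comm: "C o\<^sub>L id_blinfun = id_blinfun o\<^sub>L C" for C :: "'a \<Rightarrow>\<^sub>L 'a"
    by (rule blinfun_eqI) simp
  obtain Y where Y: "sqrt_iter ?A \<longlonglongrightarrow> Y"
    using sqrt_iter_convergent[OF X] unfolding convergent_def by blast
  have Yx: "(\<lambda>n. sqrt_iter ?A n x) \<longlonglongrightarrow> Y x" for x
    by (intro blinfun.tendsto Y tendsto_const)
  have "norm Y \<le> 1"
    by (rule LIMSEQ_le_const2[OF tendsto_norm[OF Y]])
      (use norm_sqrt_iter_le[OF X] sqrt_majorant_bounds order_trans in blast)
  have "(\<lambda>n. sqrt_iter ?A (Suc n)) \<longlonglongrightarrow> (1 / 2) *\<^sub>R (?A + (Y o\<^sub>L Y))"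
    unfolding sqrt_iter.simps by (intro tendsto_intros blinfun_compose.tendsto Y)
  then have fix_eq: "Y = (1 / 2) *\<^sub>R (?A + (Y o\<^sub>L Y))"
    by (rule LIMSEQ_unique[OF LIMSEQ_Suc[OF Y]])
  have "inner (sqrt_iter ?A n x) y = inner x (sqrt_iter ?A n y)" for n x y
    by (induction n arbitrary: x y)
      (simp_all add: plus_blinfun.rep_eq minus_blinfun.rep_eq scaleR_blinfun.rep_eq sym
        inner_add_left inner_add_right inner_diff_left inner_diff_right)
  then have symY: "inner (Y x) y = inner x (Y y)" for x y
    by (intro LIMSEQ_unique[OF tendsto_inner[OF Yx tendsto_const]])
      (simp add: tendsto_inner[OF tendsto_const Yx])
  have commY: "C o\<^sub>L Y = Y o\<^sub>L C" if "C o\<^sub>L X = X o\<^sub>L C" for C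
  proof -
    have "C o\<^sub>L ?A = ?A o\<^sub>L C"
      using that by (simp add: blinfun_compose.diff_left blinfun_compose.diff_right id_comm)
    then have "C o\<^sub>L sqrt_iter ?A n = sqrt_iter ?A n o\<^sub>L C" for n
      by (rule sqrt_iter_commute)
    then show ?thesis
      by (intro LIMSEQ_unique[OF blinfun_compose.tendsto[OF tendsto_const Y]])
        (simp add: blinfun_compose.tendsto[OF Y tendsto_const])
  qed
  show ?thesis
  proof (intro exI[of _ "id_blinfun - Y"] conjI allI impI)
    show "(id_blinfun - Y) ((id_blinfun - Y) x) = X x" for x
    proof -
      have "2 *\<^sub>R Y x = x - X x + Y (Y x)"
        by (subst fix_eq) (simp add: plus_blinfun.rep_eq minus_blinfun.rep_eq scaleR_blinfun.rep_eq)
      then show ?thesis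
        by (simp add: minus_blinfun.rep_eq blinfun.diff_right algebra_simps scaleR_2)
    qed
    show "C o\<^sub>L (id_blinfun - Y) = (id_blinfun - Y) o\<^sub>L C" if "C o\<^sub>L X = X o\<^sub>L C" for C
      using commY[OF that] by (simp add: blinfun_compose.diff_left blinfun_compose.diff_right
          id_comm)
  qed (use \<open>norm Y \<le> 1\<close> symY in
      \<open>simp_all add: minus_blinfun.rep_eq inner_diff_left inner_diff_right\<close>)
qed

text \<open>By Cauchy-Schwarz, |x|^2 - <x, R x> is at most |x|^2. Thus the norm bound kept for the
  root is what makes it non-negative.\<close>

lemma blinfun_inner_nonneg:
  fixes R :: "'a::real_inner \<Rightarrow>\<^sub>L 'a"
  assumes "norm (id_blinfun - R) \<le> 1"
  shows "0 \<le> inner x (R x)"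
proof -
  have "inner x ((id_blinfun - R) x) \<le> norm x * norm ((id_blinfun - R) x)"
    by (rule norm_cauchy_schwarz)
  also have "\<dots> \<le> norm x * (1 * norm x)"
    using order_trans[OF norm_blinfun mult_right_mono[OF assms norm_ge_zero]]
    by (intro mult_left_mono) auto
  finally show ?thesis
    by (simp add: minus_blinfun.rep_eq inner_diff_right power2_eq_square
        flip: power2_norm_eq_inner)
qed

section \<open>Non-negative selfadjoint operators\<close>

lemma cinner_eq_inner: "cinner x y = Complex (inner x y) (inner x ((- \<i>) *\<^sub>C y))"
  by (simp add: inner_eq_Re_cinner cinner_scaleC_right complex_eq_iff
      del: complex_vector.scale_minus_left)

lemma cinner_add_left: "cinner (x + y) z = cinner x z + cinner y z"
  by (metis cinner_add_right cinner_commute complex_cnj_add)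

lemma cinner_scaleC_left: "cinner (a *\<^sub>C x) y = cnj a * cinner x y"
  by (metis cinner_commute cinner_scaleC_right complex_cnj_mult)

lemma inner_scaleC_left: "inner (a *\<^sub>C x) y = inner x (cnj a *\<^sub>C y)"
  by (simp add: inner_eq_Re_cinner cinner_scaleC_right cinner_scaleC_left)

lemma norm_scaleC: "norm (a *\<^sub>C x) = cmod a * norm (x::'h::chilbert_space)"
proof -
  have "inner (a *\<^sub>C x) (a *\<^sub>C x) = inner x ((cnj a * a) *\<^sub>C x)"
    by (simp add: inner_scaleC_left scaleC_scaleC)
  also have "(cnj a * a) *\<^sub>C x = (cmod a)\<^sup>2 *\<^sub>R x"
    by (metis complex_norm_square mult.commute scaleC_of_real)
  finally have "(norm (a *\<^sub>C x))\<^sup>2 = (cmod a * norm x)\<^sup>2"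
    by (simp add: power2_norm_eq_inner power_mult_distrib)
  then show ?thesis
    by (simp add: power2_eq_iff_nonneg)
qed

lemma bounded_linear_scaleC: "bounded_linear (\<lambda>x::'h::chilbert_space. a *\<^sub>C x)"
proof (rule bounded_linear_intro[where K = "cmod a"])
  show "a *\<^sub>C (r *\<^sub>R x) = r *\<^sub>R (a *\<^sub>C x)" for r and x :: 'h
    by (simp only: scaleC_scaleC mult.commute flip: scaleC_of_real)
qed (simp_all add: scaleC_add_right norm_scaleC)

lemma csubspace_imp_subspace:
  fixes S :: "'h::chilbert_space set"
  assumes "csubspace S"
  shows "subspace S"
  unfolding subspace_def
  using complex_vector.subspace_0[OF assms] complex_vector.subspace_add[OF assms]
    complex_vector.subspace_scale[OF assms, of _ "complex_of_real _"]
  by (simp add: scaleC_of_real)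

text \<open>A complex subspace is invariant under multiplication by -i, so the real identities
  already contain the imaginary parts. The adjoint thereby becomes accessible to the real form
  lemmas.\<close>

lemma adjoint_op_iff_inner:
  fixes T :: "'h::chilbert_space op"
  assumes "csubspace T"
  shows "(g, h) \<in> adjoint_op T \<longleftrightarrow> (\<forall>(x, y)\<in>T. inner g y = inner h x)"
proof
  show "\<forall>(x, y)\<in>T. inner g y = inner h x" if "(g, h) \<in> adjoint_op T"
    using that by (auto simp: adjoint_op_def inner_eq_Re_cinner)
next
  assume *: "\<forall>(x, y)\<in>T. inner g y = inner h x"
  have "cinner g y = cinner h x" if xy: "(x, y) \<in> T" for x y
  proof -
    have "((- \<i>) *\<^sub>C x, (- \<i>) *\<^sub>C y) \<in> T"
      using complex_vector.subspace_scale[OF assms xy, of "- \<i>"] by (simp add: scaleC_prod_def)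
    with xy * have "inner g y = inner h x" "inner g ((- \<i>) *\<^sub>C y) = inner h ((- \<i>) *\<^sub>C x)"
      by auto
    then show ?thesis
      by (simp add: cinner_eq_inner)
  qed
  then show "(g, h) \<in> adjoint_op T"
    by (auto simp: adjoint_op_def)
qed

lemma dense_inner_eq_0:
  fixes x :: "'a::real_inner"
  assumes "closure S = UNIV" and "\<And>y. y \<in> S \<Longrightarrow> inner x y = 0"
  shows "x = 0"
proof -
  have "S \<subseteq> {y. inner x y = 0}"
    using assms(2) by auto
  then have "closure S \<subseteq> {y. inner x y = 0}"
    by (intro closure_minimal closed_Collect_eq continuous_intros)
  with assms(1) have "inner x x = 0"
    by blast
  then show ?thesis
    by simp
qed

lemma op_apply_eq: "single_valued T \<Longrightarrow> (x, y) \<in> T \<Longrightarrow> T \<cdot> x = y"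
  unfolding op_apply_def by (blast dest: single_valuedD)

lemma op_apply_mem: "single_valued T \<Longrightarrow> x \<in> Domain T \<Longrightarrow> (x, T \<cdot> x) \<in> T"
  by (metis DomainE op_apply_eq)

text \<open>A purely real criterion. Two values at one point differ by a vector orthogonal to the
  dense domain, which gives single-valuedness; \<open>max\<close> says that the adjoint is contained
  in the operator.\<close>

lemma nonneg_selfadjointI:
  fixes T :: "'h::chilbert_space op"
  assumes sub: "csubspace T" and dense: "closure (Domain T) = UNIV"
    and sym: "\<And>x y x' y'. (x, y) \<in> T \<Longrightarrow> (x', y') \<in> T \<Longrightarrow> inner x y' = inner y x'"
    and pos: "\<And>x y. (x, y) \<in> T \<Longrightarrow> 0 \<le> inner x y"
    and max: "\<And>g h. (\<And>x y. (x, y) \<in> T \<Longrightarrow> inner g y = inner h x) \<Longrightarrow> (g, h) \<in> T"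
  shows "nonneg_selfadjoint T"
proof -
  have "y = y'" if "(x, y) \<in> T" "(x, y') \<in> T" for x y y'
  proof -
    have "y - y' = 0"
    proof (rule dense_inner_eq_0[OF dense])
      fix u assume "u \<in> Domain T"
      then obtain w where "(u, w) \<in> T"
        by blast
      then show "inner (y - y') u = 0"
        using sym[OF that(1)] sym[OF that(2)] by (simp add: inner_diff_left)
    qed
    then show ?thesis
      by simp
  qed
  then have sv: "single_valued T"
    by (auto intro: single_valuedI)
  have adj: "adjoint_op T = T"
  proof (rule set_eqI, clarify)
    show "(g, h) \<in> adjoint_op T \<longleftrightarrow> (g, h) \<in> T" for g h
      unfolding adjoint_op_iff_inner[OF sub] using sym max[of g h] by blast
  qed
  have "cinner f (T \<cdot> f) \<in> \<real>\<^sub>\<ge>\<^sub>0" if "f \<in> Domain T" for f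
  proof -
    have Tf: "(f, T \<cdot> f) \<in> T"
      by (rule op_apply_mem[OF sv that])
    then have "(f, T \<cdot> f) \<in> adjoint_op T"
      using adj by simp
    with Tf have "cinner f (T \<cdot> f) = cinner (T \<cdot> f) f"
      unfolding adjoint_op_def by blast
    then have "cinner f (T \<cdot> f) = cnj (cinner f (T \<cdot> f))"
      using cinner_commute[of "T \<cdot> f" f] by simp
    then show ?thesis
      using pos[OF Tf] by (simp add: complex_nonneg_Reals_iff inner_eq_Re_cinner complex_eq_iff)
  qed
  then show ?thesis
    using sub sv dense adj by (simp add: nonneg_selfadjoint_def densely_defined_def is_operator_def)
qed

section \<open>Closedness, resolvent and square root\<close>

context
  fixes T :: "'h::chilbert_space op"
  assumes T: "nonneg_selfadjoint T"
begin

lemma nonneg_selfadjoint_csubspace: "csubspace T"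
  and nonneg_selfadjoint_single_valued: "single_valued T"
  and nonneg_selfadjoint_dense: "closure (Domain T) = UNIV"
  using T by (simp_all add: nonneg_selfadjoint_def densely_defined_def is_operator_def)

lemma nonneg_selfadjoint_iff: "(g, h) \<in> T \<longleftrightarrow> (\<forall>(x, y)\<in>T. inner g y = inner h x)"
  using T adjoint_op_iff_inner[OF nonneg_selfadjoint_csubspace] by (simp add: nonneg_selfadjoint_def)

lemma nonneg_selfadjoint_sym: "(x, y) \<in> T \<Longrightarrow> (x', y') \<in> T \<Longrightarrow> inner x y' = inner y x'"
  using nonneg_selfadjoint_iff by auto

lemma nonneg_selfadjoint_nonneg: "(x, y) \<in> T \<Longrightarrow> 0 \<le> inner x y"
  using T op_apply_eq[OF nonneg_selfadjoint_single_valued]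
  by (force simp: nonneg_selfadjoint_def complex_nonneg_Reals_iff inner_eq_Re_cinner)

lemma nonneg_selfadjoint_closed:
  assumes F: "\<And>n. F n \<in> T" and x: "(\<lambda>n. fst (F n)) \<longlonglongrightarrow> x" and y: "(\<lambda>n. snd (F n)) \<longlonglongrightarrow> y"
  shows "(x, y) \<in> T"
proof (rule nonneg_selfadjoint_iff[THEN iffD2], clarify)
  fix u w assume uw: "(u, w) \<in> T"
  show "inner x w = inner y u"
  proof (rule LIMSEQ_unique)
    show "(\<lambda>n. inner (fst (F n)) w) \<longlonglongrightarrow> inner x w"
      by (intro tendsto_intros x)
    have "inner (fst (F n)) w = inner (snd (F n)) u" for n
      using nonneg_selfadjoint_sym[of "fst (F n)" "snd (F n)"] F[of n] uw by simp
    then show "(\<lambda>n. inner (fst (F n)) w) \<longlonglongrightarrow> inner y u"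
      by (simp add: tendsto_inner[OF y tendsto_const])
  qed
qed

text \<open>Every \<open>z\<close> is of the form \<open>x + T x\<close>: the orthogonal projection of \<open>z\<close> onto the closed range
  of \<open>1 + T\<close> leaves a remainder that is an eigenvector of \<open>T\<close> with eigenvalue \<open>-1\<close>.\<close>

lemma nonneg_selfadjoint_resolvent:
  obtains x y where "(x, y) \<in> T" "z = x + y"
proof -
  define m where "m p q = inner (fst p + snd p) (fst q + snd q)" for p q :: "'h \<times> 'h"
  have bil: "bilinear m"
    unfolding bilinear_def
    by (intro conjI allI linearI) (simp_all add: m_def inner_add_left inner_add_right algebra_simps)
  have lin: "linear (\<lambda>p. inner z (fst p + snd p))"
    by (intro linearI) (simp_all add: inner_add_right algebra_simps)
  have sym: "m p q = m q p" for p q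
    by (simp add: m_def inner_commute)
  have pos: "0 \<le> m p p" for p
    by (simp add: m_def)
  have bound: "(inner z (fst f + snd f))\<^sup>2 \<le> inner z z * m f f" for f
    unfolding m_def by (rule Cauchy_Schwarz_ineq)
  have sub: "subspace T"
    by (rule csubspace_imp_subspace[OF nonneg_selfadjoint_csubspace])
  obtain F e where F: "\<And>n. F n \<in> T" and e: "e \<longlonglongrightarrow> 0"
    and mF: "\<And>i j. m (F i - F j) (F i - F j) \<le> e i + e j"
    and lim: "\<And>g. g \<in> T \<Longrightarrow> (\<lambda>n. m (F n) g) \<longlonglongrightarrow> inner z (fst g + snd g)"
    using form_riesz[OF bil sub sym pos lin bound] by blast
  \<comment> \<open>The cross term in |x + T x|^2 is non-negative, so a sequence that is Cauchy for
    the form is Cauchy in both components.\<close>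
  have ge: "(norm (fst p))\<^sup>2 \<le> m p p" "(norm (snd p))\<^sup>2 \<le> m p p" if "p \<in> T" for p
    using nonneg_selfadjoint_nonneg[of "fst p" "snd p"] that
    by (simp_all add: m_def power2_norm_eq_inner inner_add_left inner_add_right inner_commute)
  have diff: "F i - F j \<in> T" for i j
    by (intro subspace_diff csubspace_imp_subspace nonneg_selfadjoint_csubspace F)
  have "Cauchy (\<lambda>n. fst (F n))"
    by (rule Cauchy_if_square_dist_le[OF e]) (use order_trans[OF ge(1)[OF diff] mF] in simp)
  then obtain x where x: "(\<lambda>n. fst (F n)) \<longlonglongrightarrow> x"
    by (meson Cauchy_convergent convergentD)
  have "Cauchy (\<lambda>n. snd (F n))"
    by (rule Cauchy_if_square_dist_le[OF e]) (use order_trans[OF ge(2)[OF diff] mF] in simp)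
  then obtain y where y: "(\<lambda>n. snd (F n)) \<longlonglongrightarrow> y"
    by (meson Cauchy_convergent convergentD)
  have eq: "inner (x + y) (u + w) = inner z (u + w)" if "(u, w) \<in> T" for u w
  proof (rule LIMSEQ_unique)
    show "(\<lambda>n. m (F n) (u, w)) \<longlonglongrightarrow> inner (x + y) (u + w)"
      unfolding m_def by (simp, intro tendsto_intros x y)
    show "(\<lambda>n. m (F n) (u, w)) \<longlonglongrightarrow> inner z (u + w)"
      using lim[OF that] by simp
  qed
  define r where "r = z - x - y"
  have "(r, - r) \<in> T"
  proof (rule nonneg_selfadjoint_iff[THEN iffD2], clarify)
    fix u w assume "(u, w) \<in> T"
    from eq[OF this] show "inner r w = inner (- r) u"
      by (simp add: r_def inner_diff_left inner_add_left inner_add_right)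
  qed
  then have "0 \<le> - inner r r"
    using nonneg_selfadjoint_nonneg by fastforce
  then have "r = 0"
    using inner_ge_zero[of r] inner_eq_zero_iff[of r] by linarith
  then have "z = x + y"
    by (simp add: r_def algebra_simps)
  moreover have "(x, y) \<in> T"
    by (rule nonneg_selfadjoint_closed[OF F x y])
  ultimately show thesis
    using that by blast
qed

end

text \<open>With \<open>R\<close> and \<open>Q\<close> the square roots of \<open>(1 + B)\<^sup>-\<^sup>1\<close> and \<open>1 - (1 + B)\<^sup>-\<^sup>1\<close>, the square root of
  \<open>B\<close> is \<open>Q R\<^sup>-\<^sup>1\<close>.\<close>

lemma nonneg_selfadjoint_sqrt_exists:
  fixes B :: "'h::chilbert_space op"
  assumes B: "nonneg_selfadjoint B"
  obtains S where "nonneg_selfadjoint S" "S O S = B"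
proof -
  note subB = csubspace_imp_subspace[OF nonneg_selfadjoint_csubspace[OF B]]
  have "\<exists>x. (x, z - x) \<in> B" for z
  proof -
    obtain x y where "(x, y) \<in> B" "z = x + y"
      by (rule nonneg_selfadjoint_resolvent[OF B])
    then show ?thesis
      by (intro exI[of _ x]) simp
  qed
  \<comment> \<open>\<open>t\<close> is the resolvent (1 + B)^-1.\<close>
  then obtain t where t: "\<And>z. (t z, z - t z) \<in> B"
    by metis
  have contr: "(norm x)\<^sup>2 + (norm y)\<^sup>2 \<le> (norm (x + y))\<^sup>2" if "(x, y) \<in> B" for x y
    using nonneg_selfadjoint_nonneg[OF B that]
    by (simp add: power2_norm_eq_inner inner_add_left inner_add_right inner_commute)
  have uniq: "x = t z" if "(x, z - x) \<in> B" for x z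
  proof -
    have "(x - t z, t z - x) \<in> B"
      using subspace_diff[OF subB that t[of z]] by simp
    from contr[OF this] have "(norm (x - t z))\<^sup>2 + (norm (t z - x))\<^sup>2 \<le> 0"
      by simp
    then have "(norm (x - t z))\<^sup>2 \<le> 0"
      using zero_le_power2[of "norm (t z - x)"] by linarith
    then show ?thesis
      by simp
  qed
  have t_scaleC: "t (c *\<^sub>C z) = c *\<^sub>C t z" for c z
  proof (rule uniq[symmetric])
    show "(c *\<^sub>C t z, c *\<^sub>C z - c *\<^sub>C t z) \<in> B"
      using complex_vector.subspace_scale[OF nonneg_selfadjoint_csubspace[OF B] t[of z], of c]
      by (simp add: scaleC_prod_def complex_vector.scale_right_diff_distrib)
  qed
  have norm_t: "norm (t z) \<le> norm z" "norm (z - t z) \<le> norm z" for z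
  proof -
    have "(norm (t z))\<^sup>2 + (norm (z - t z))\<^sup>2 \<le> (norm z)\<^sup>2"
      using contr[OF t[of z]] by simp
    then have "(norm (t z))\<^sup>2 \<le> (norm z)\<^sup>2" "(norm (z - t z))\<^sup>2 \<le> (norm z)\<^sup>2"
      using zero_le_power2[of "norm (t z)"] zero_le_power2[of "norm (z - t z)"] by linarith+
    then show "norm (t z) \<le> norm z" "norm (z - t z) \<le> norm z"
      by (simp_all add: power2_le_iff_abs_le)
  qed
  have t_lin: "bounded_linear t"
  proof (rule bounded_linear_intro[where K = 1])
    show "t (z + w) = t z + t w" for z w
      by (rule uniq[symmetric]) (use subspace_add[OF subB t[of z] t[of w]] in \<open>simp add: algebra_simps\<close>)
    show "t (r *\<^sub>R z) = r *\<^sub>R t z" for r z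
      using t_scaleC[of "complex_of_real r" z] by (simp add: scaleC_of_real)
  qed (simp add: norm_t)
  define T where "T = Blinfun t"
  have T: "T z = t z" for z
    by (simp add: T_def bounded_linear_Blinfun_apply[OF t_lin])
  \<comment> \<open>Scalar multiplications as bounded operators: the commutation clauses applied to
    them make \<open>R\<close> and \<open>Q\<close> complex homogeneous.\<close>
  define M where "M c = Blinfun (\<lambda>x::'h. c *\<^sub>C x)" for c
  have M: "M c x = c *\<^sub>C x" for c x
    by (simp add: M_def bounded_linear_Blinfun_apply[OF bounded_linear_scaleC])
  have symT: "inner (T x) y = inner x (T y)" for x y
    using nonneg_selfadjoint_sym[OF B t[of x] t[of y]]
    by (simp add: T inner_diff_left inner_diff_right)
  have MT: "M c o\<^sub>L T = T o\<^sub>L M c" for c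
    by (rule blinfun_eqI) (simp add: T M t_scaleC)
  have le1: "norm T \<le> 1" "norm (id_blinfun - T) \<le> 1"
    using norm_t by (auto intro!: norm_blinfun_bound simp: T minus_blinfun.rep_eq)
  obtain R where R: "norm (id_blinfun - R) \<le> 1" "\<And>x y. inner (R x) y = inner x (R y)"
      "\<And>x. R (R x) = T x" "\<And>C. C o\<^sub>L T = T o\<^sub>L C \<Longrightarrow> C o\<^sub>L R = R o\<^sub>L C"
    using blinfun_sqrt_exists[OF le1(2) symT] by blast
  obtain Q where Q_le: "norm (id_blinfun - Q) \<le> 1" and Q: "\<And>x y. inner (Q x) y = inner x (Q y)"
      "\<And>x. Q (Q x) = (id_blinfun - T) x"
      "\<And>C. C o\<^sub>L (id_blinfun - T) = (id_blinfun - T) o\<^sub>L C \<Longrightarrow> C o\<^sub>L Q = Q o\<^sub>L C"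
  proof -
    have "norm (id_blinfun - (id_blinfun - T)) \<le> 1"
      using le1(1) by simp
    moreover have "inner ((id_blinfun - T) x) y = inner x ((id_blinfun - T) y)" for x y
      by (simp add: symT minus_blinfun.rep_eq inner_diff_left inner_diff_right)
    ultimately show thesis
      using blinfun_sqrt_exists[of "id_blinfun - T"] that by blast
  qed
  \<comment> \<open>A further root, P^2 = R, serves positivity: <R u, Q u> = <P u, Q (P u)>.\<close>
  obtain P :: "'h \<Rightarrow>\<^sub>L 'h" where P: "\<And>x y. inner (P x) y = inner x (P y)" "\<And>x. P (P x) = R x"
      "\<And>C. C o\<^sub>L R = R o\<^sub>L C \<Longrightarrow> C o\<^sub>L P = P o\<^sub>L C"
    using blinfun_sqrt_exists[OF R(1,2)] by blast
  have comm1: "C o\<^sub>L (id_blinfun - T) = (id_blinfun - T) o\<^sub>L C" if "C o\<^sub>L T = T o\<^sub>L C" for C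
  proof (rule blinfun_eqI)
    fix x
    have "C (T x) = T (C x)"
      using that by (metis blinfun_apply_blinfun_compose)
    then show "(C o\<^sub>L (id_blinfun - T)) x = ((id_blinfun - T) o\<^sub>L C) x"
      by (simp add: minus_blinfun.rep_eq blinfun.diff_right)
  qed
  \<comment> \<open>\<open>R\<close> commutes with its square \<open>T\<close>, hence with 1 - T and
    with its root \<open>Q\<close>; then \<open>Q\<close> commutes with the root \<open>P\<close> of
    \<open>R\<close>.\<close>
  have "R o\<^sub>L T = T o\<^sub>L R"
    by (rule blinfun_eqI) (simp flip: R(3))
  from Q(3)[OF comm1[OF this]] have RQ': "R o\<^sub>L Q = Q o\<^sub>L R" .
  then have RQ: "R (Q x) = Q (R x)" for x
    by (metis blinfun_apply_blinfun_compose)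
  have QP: "Q (P x) = P (Q x)" for x
    using P(3)[OF RQ'[symmetric]] by (metis blinfun_apply_blinfun_compose)
  have MR: "R (c *\<^sub>C x) = c *\<^sub>C R x" for c x
    using R(4)[OF MT[of c]] by (metis M blinfun_apply_blinfun_compose)
  have MQ: "Q (c *\<^sub>C x) = c *\<^sub>C Q x" for c x
    using Q(3)[OF comm1[OF MT[of c]]] by (metis M blinfun_apply_blinfun_compose)
  have one: "R (R x) + Q (Q x) = x" for x
    by (simp add: R(3) Q(2) minus_blinfun.rep_eq)
  have "inj R"
  proof (rule injI)
    fix x y assume "R x = R y"
    then have "t x = t y"
      using R(3) T by metis
    then have "(0, x - y) \<in> B"
      using subspace_diff[OF subB t[of x] t[of y]] by simp
    then have "x - y = 0"
      using nonneg_selfadjoint_dense[OF B] nonneg_selfadjoint_sym[OF B]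
      by (intro dense_inner_eq_0[of "Domain B"]) force+
    then show "x = y"
      by simp
  qed
  \<comment> \<open>The graph of Q R^-1, parametrised by u so that no inverse has to be
    formed.\<close>
  define S where "S = range (\<lambda>u. (R u, Q u))"
  have SS: "S O S = B"
  proof (intro set_eqI iffI)
    fix p assume "p \<in> S O S"
    then obtain u w where p: "p = (R u, Q w)" and uw: "Q u = R w"
      by (auto simp: S_def)
    \<comment> \<open>Since R^2 + Q^2 = 1 and Q u = R w, this vector satisfies R a = u and Q a = w;
      hence p = (R^2 a, Q^2 a) lies in \<open>B\<close>.\<close>
    define a where "a = R u + Q w"
    have "R a = R (R u) + Q (R w)"
      by (simp add: a_def blinfun.add_right RQ)
    also have "\<dots> = u"
      by (simp add: one flip: uw)
    finally have Ra: "R a = u" .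
    then have "R w = R (Q a)"
      by (simp add: RQ flip: uw)
    then have "w = Q a"
      by (rule injD[OF \<open>inj R\<close>])
    then show "p \<in> B"
      using t[of a] R(3)[of a] by (simp add: p Ra Q(2) T minus_blinfun.rep_eq)
  next
    fix p assume "p \<in> B"
    moreover obtain x y where xy: "p = (x, y)"
      by fastforce
    ultimately have "x = t (x + y)"
      by (intro uniq) simp
    then have "p = (R (R (x + y)), Q (Q (x + y)))"
      by (metis xy T R(3) one add_diff_cancel_left')
    moreover have "(R (R (x + y)), Q (R (x + y))) \<in> S" "(R (Q (x + y)), Q (Q (x + y))) \<in> S"
      unfolding S_def by blast+
    ultimately show "p \<in> S O S"
      by (auto simp: RQ)
  qed
  have "nonneg_selfadjoint S"
  proof (rule nonneg_selfadjointI)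
    show "csubspace S"
    proof (rule complex_vector.subspaceI)
      show "0 \<in> S"
        unfolding S_def by (rule range_eqI[of _ _ 0]) (simp add: blinfun.zero_right zero_prod_def)
      show "p + q \<in> S" if "p \<in> S" "q \<in> S" for p q
        using that unfolding S_def by (auto simp flip: blinfun.add_right)
      show "c *\<^sub>C p \<in> S" if "p \<in> S" for c p
        using that unfolding S_def by (auto simp: scaleC_prod_def simp flip: MR MQ)
    qed
    have "Domain B \<subseteq> Domain S"
      using SS by blast
    then show "closure (Domain S) = UNIV"
      using closure_mono nonneg_selfadjoint_dense[OF B] by blast
    show "inner x y' = inner y x'" if "(x, y) \<in> S" "(x', y') \<in> S" for x y x' y'
      using that by (auto simp: S_def R(2) Q(1) RQ)
    show "0 \<le> inner x y" if xy: "(x, y) \<in> S" for x y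
    proof -
      obtain u where "x = P (P u)" "y = Q u"
        using xy by (auto simp: S_def P(2))
      then have "inner x y = inner (P u) (Q (P u))"
        by (simp only: P(1)[of "P u"] QP)
      then show ?thesis
        using blinfun_inner_nonneg[OF Q_le] by simp
    qed
    show "(g, h) \<in> S" if "\<And>x y. (x, y) \<in> S \<Longrightarrow> inner g y = inner h x" for g h
    proof -
      have "inner (Q g) u = inner (R h) u" for u
        using that[of "R u" "Q u"] by (simp add: S_def Q(1) R(2))
      then have eq: "Q g = R h"
        by (metis inner_eq_zero_iff inner_diff_left right_minus_eq)
      \<comment> \<open>Again by R^2 + Q^2 = 1, now with Q g = R h, this recovers the parameter of
        the point (g, h).\<close>
      define u where "u = R g + Q h"
      have "R u = g" "Q u = h"
        using one[of g] one[of h] by (simp_all add: u_def blinfun.add_right RQ eq flip: RQ)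
      then show ?thesis
        by (auto simp: S_def)
    qed
  qed
  with SS show thesis
    using that by blast
qed

section \<open>The form domain\<close>

lemma op_sqrt:
  assumes "nonneg_selfadjoint B"
  shows nonneg_selfadjoint_op_sqrt: "nonneg_selfadjoint (op_sqrt B)"
    and op_sqrt_square: "op_sqrt B O op_sqrt B = B"
proof -
  have "\<exists>S. nonneg_selfadjoint S \<and> S O S = B"
    using nonneg_selfadjoint_sqrt_exists[OF assms] by blast
  from someI_ex[OF this] show "nonneg_selfadjoint (op_sqrt B)" "op_sqrt B O op_sqrt B = B"
    unfolding op_sqrt_def by blast+
qed

text \<open>The equation y + r S^2 y = z is solved by minimising |y|^2 + r |S y|^2 - 2 <z, y> over
  the graph of \<open>S\<close>.\<close>

lemma nonneg_selfadjoint_square_resolvent: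
  fixes S :: "'h::chilbert_space op"
  assumes S: "nonneg_selfadjoint S" and "0 < r"
  obtains y u w where "(y, u) \<in> S" "(u, w) \<in> S" "z = y + r *\<^sub>R w"
proof -
  define m where "m p q = inner (fst p) (fst q) + r * inner (snd p) (snd q)" for p q :: "'h \<times> 'h"
  have bil: "bilinear m"
    unfolding bilinear_def
    by (intro conjI allI linearI) (simp_all add: m_def inner_add_left inner_add_right algebra_simps)
  have lin: "linear (\<lambda>p. inner z (fst p))"
    by (intro linearI) (simp_all add: inner_add_right)
  have sub: "subspace S"
    by (rule csubspace_imp_subspace[OF nonneg_selfadjoint_csubspace[OF S]])
  have bound: "(inner z (fst f))\<^sup>2 \<le> inner z z * m f f" for f
  proof -
    have "(inner z (fst f))\<^sup>2 \<le> inner z z * inner (fst f) (fst f)"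
      by (rule Cauchy_Schwarz_ineq)
    also have "\<dots> \<le> inner z z * m f f"
      using \<open>0 < r\<close> by (intro mult_left_mono) (simp_all add: m_def)
    finally show ?thesis .
  qed
  have sym: "m p q = m q p" for p q
    by (simp add: m_def inner_commute)
  have pos: "0 \<le> m p p" for p
    using \<open>0 < r\<close> by (simp add: m_def)
  obtain F e where F: "\<And>n. F n \<in> S" and e: "e \<longlonglongrightarrow> 0"
    and mF: "\<And>i j. m (F i - F j) (F i - F j) \<le> e i + e j"
    and lim: "\<And>g. g \<in> S \<Longrightarrow> (\<lambda>n. m (F n) g) \<longlonglongrightarrow> inner z (fst g)"
    using form_riesz[OF bil sub sym pos lin bound] by blast
  have "(norm (fst (F i) - fst (F j)))\<^sup>2 \<le> e i + e j" for i j
  proof -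
    have "(norm (fst p))\<^sup>2 \<le> m p p" for p
      using \<open>0 < r\<close> by (simp add: m_def power2_norm_eq_inner)
    from order_trans[OF this mF] show ?thesis
      by simp
  qed
  then have "Cauchy (\<lambda>n. fst (F n))"
    by (rule Cauchy_if_square_dist_le[OF e])
  then obtain y where y: "(\<lambda>n. fst (F n)) \<longlonglongrightarrow> y"
    by (meson Cauchy_convergent convergentD)
  have "(norm (snd (F i) - snd (F j)))\<^sup>2 \<le> e i / r + e j / r" for i j
  proof -
    have "r * (norm (snd p))\<^sup>2 \<le> m p p" for p
      by (simp add: m_def power2_norm_eq_inner)
    from order_trans[OF this mF] show ?thesis
      using \<open>0 < r\<close> by (simp add: field_simps)
  qed
  then have "Cauchy (\<lambda>n. snd (F n))"
    using \<open>0 < r\<close> by (intro Cauchy_if_square_dist_le[of "\<lambda>n. e n / r"] tendsto_divide_zero e)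
  then obtain u where u: "(\<lambda>n. snd (F n)) \<longlonglongrightarrow> u"
    by (meson Cauchy_convergent convergentD)
  have yu: "(y, u) \<in> S"
    by (rule nonneg_selfadjoint_closed[OF S F y u])
  \<comment> \<open>The Euler equation <y, g> + r <u, S g> = <z, g> says that \<open>u\<close> lies
    in the domain of the adjoint of \<open>S\<close> with this value.\<close>
  define w where "w = (1 / r) *\<^sub>R (z - y)"
  have "(u, w) \<in> S"
  proof (rule nonneg_selfadjoint_iff[OF S, THEN iffD2], clarify)
    fix g g' assume g: "(g, g') \<in> S"
    have "inner y g + r * inner u g' = inner z g"
    proof (rule LIMSEQ_unique)
      show "(\<lambda>n. m (F n) (g, g')) \<longlonglongrightarrow> inner y g + r * inner u g'"
        unfolding m_def by (simp, intro tendsto_intros y u)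
      show "(\<lambda>n. m (F n) (g, g')) \<longlonglongrightarrow> inner z g"
        using lim[OF g] by simp
    qed
    then show "inner u g' = inner w g"
      using \<open>0 < r\<close> by (simp add: w_def inner_diff_left field_simps)
  qed
  moreover have "z = y + r *\<^sub>R w"
    using \<open>0 < r\<close> by (simp add: w_def)
  ultimately show thesis
    using that yu by blast
qed

text \<open>The vectors \<open>y = (1 + r S\<^sup>2)\<^sup>-\<^sup>1 h\<close> converge to \<open>h\<close> as \<open>r\<close> tends to \<open>0\<close> and satisfy
  \<open>norm (S y) \<le> sqrt c\<close>, which makes \<open>inner h (S g)\<close> bounded in \<open>g\<close>.\<close>

lemma in_sqrt_domain_if_form_bound:
  fixes S :: "'h::chilbert_space op"
  assumes S: "nonneg_selfadjoint S" and "0 \<le> c"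
    and bound: "\<And>y w. (y, w) \<in> S O S \<Longrightarrow> (inner h w)\<^sup>2 \<le> c * inner y w"
  obtains k where "(h, k) \<in> S" "(norm k)\<^sup>2 \<le> c"
proof -
  have approx: "\<exists>y u. (y, u) \<in> S \<and> inner u u \<le> c \<and> (norm (h - y))\<^sup>2 \<le> r * c" if r: "0 < r" for r
  proof -
    obtain y u w where yu: "(y, u) \<in> S" and uw: "(u, w) \<in> S" and h: "h = y + r *\<^sub>R w"
      by (rule nonneg_selfadjoint_square_resolvent[OF S r])
    define a where "a = inner u u"
    define b where "b = r * inner w w"
    have "a \<ge> 0" "b \<ge> 0"
      using r by (simp_all add: a_def b_def)
    have yw: "inner y w = a"
      using nonneg_selfadjoint_sym[OF S yu uw] by (simp add: a_def)
    have "inner h w = a + b"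
      by (simp add: h inner_add_left yw b_def)
    moreover have "(y, w) \<in> S O S"
      using yu uw by blast
    ultimately have ab: "(a + b)\<^sup>2 \<le> c * a"
      using bound yw by metis
    \<comment> \<open>Here a = |S y|^2 and b = r |S^2 y|^2. From (a + b)^2 <= c a <= c (a + b) both
      are at most \<open>c\<close>: the first bounds S y, the second forces y towards h as r tends
      to 0.\<close>
    have "a + b \<le> c"
    proof (cases "a + b = 0")
      case False
      then have "0 < a + b"
        using \<open>a \<ge> 0\<close> \<open>b \<ge> 0\<close> by simp
      moreover have "(a + b) * (a + b) \<le> c * (a + b)"
        using ab mult_nonneg_nonneg[OF \<open>0 \<le> c\<close> \<open>b \<ge> 0\<close>] by (simp add: power2_eq_square algebra_simps)
      ultimately show ?thesis
        by simp
    qed (use \<open>0 \<le> c\<close> in simp)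
    then have "a \<le> c" "b \<le> c"
      using \<open>a \<ge> 0\<close> \<open>b \<ge> 0\<close> by simp_all
    have "(norm (h - y))\<^sup>2 = r * b"
      unfolding power2_norm_eq_inner by (simp add: h b_def)
    also have "\<dots> \<le> r * c"
      using r \<open>b \<le> c\<close> by simp
    finally show ?thesis
      using yu \<open>a \<le> c\<close> unfolding a_def by blast
  qed
  have h_bound: "(inner h g')\<^sup>2 \<le> c * inner g g" if g: "(g, g') \<in> S" for g g'
  proof -
    have "\<exists>y u. (y, u) \<in> S \<and> inner u u \<le> c \<and> (norm (h - y))\<^sup>2 \<le> 1 / real (Suc n) * c" for n
      by (rule approx) simp
    then obtain y u where yu: "\<And>n. (y n, u n) \<in> S" and u: "\<And>n. inner (u n) (u n) \<le> c"
      and hy: "\<And>n. (norm (h - y n))\<^sup>2 \<le> 1 / real (Suc n) * c"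
      by metis
    have "(\<lambda>n. (norm (h - y n))\<^sup>2) \<longlonglongrightarrow> 0"
    proof (rule tendsto_sandwich[OF _ _ tendsto_const])
      show "(\<lambda>n. 1 / real (Suc n) * c) \<longlonglongrightarrow> 0"
        using LIMSEQ_Suc[OF lim_const_over_n[of c]] by simp
    qed (use hy in simp_all)
    then have "(\<lambda>n. norm (h - y n)) \<longlonglongrightarrow> 0"
      by simp
    then have "(\<lambda>n. h - y n) \<longlonglongrightarrow> 0"
      by (rule tendsto_norm_zero_cancel)
    then have "(\<lambda>n. h - (h - y n)) \<longlonglongrightarrow> h - 0"
      by (intro tendsto_intros)
    then have y: "y \<longlonglongrightarrow> h"
      by simp
    have "(inner (y n) g')\<^sup>2 \<le> c * inner g g" for n
    proof -
      have "(inner (y n) g')\<^sup>2 = (inner (u n) g)\<^sup>2"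
        using nonneg_selfadjoint_sym[OF S yu g] by simp
      also have "\<dots> \<le> inner (u n) (u n) * inner g g"
        by (rule Cauchy_Schwarz_ineq)
      also have "\<dots> \<le> c * inner g g"
        by (intro mult_right_mono u) simp
      finally show ?thesis .
    qed
    then show ?thesis
      by (intro LIMSEQ_le_const2[OF tendsto_power[OF tendsto_inner[OF y tendsto_const]]]) blast
  qed
  \<comment> \<open>The Riesz argument on the graph of \<open>S\<close> with the norm of the first
    component represents g -> <h, S g> by a vector \<open>k\<close>, so h belongs to the domain of
    the adjoint, which is \<open>S\<close>.\<close>
  define m where "m p q = inner (fst p) (fst q)" for p q :: "'h \<times> 'h"
  have bil: "bilinear m"
    unfolding bilinear_def
    by (intro conjI allI linearI) (simp_all add: m_def inner_add_left inner_add_right)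
  have lin: "linear (\<lambda>p. inner h (snd p))"
    by (intro linearI) (simp_all add: inner_add_right)
  have sub: "subspace S"
    by (rule csubspace_imp_subspace[OF nonneg_selfadjoint_csubspace[OF S]])
  have sym: "m p q = m q p" for p q
    by (simp add: m_def inner_commute)
  have pos: "0 \<le> m p p" for p
    by (simp add: m_def)
  have bd: "(inner h (snd p))\<^sup>2 \<le> c * m p p" if "p \<in> S" for p
    using h_bound[of "fst p" "snd p"] that by (simp add: m_def)
  obtain F e where F: "\<And>n. F n \<in> S" and e: "e \<longlonglongrightarrow> 0"
    and mF: "\<And>i j. m (F i - F j) (F i - F j) \<le> e i + e j"
    and lim: "\<And>g. g \<in> S \<Longrightarrow> (\<lambda>n. m (F n) g) \<longlonglongrightarrow> inner h (snd g)"
    using form_riesz[OF bil sub sym pos lin bd] by blast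
  have "Cauchy (\<lambda>n. fst (F n))"
    by (rule Cauchy_if_square_dist_le[OF e]) (use mF in \<open>simp add: m_def power2_norm_eq_inner\<close>)
  then obtain k where k: "(\<lambda>n. fst (F n)) \<longlonglongrightarrow> k"
    by (meson Cauchy_convergent convergentD)
  have kg: "inner k g = inner h g'" if g: "(g, g') \<in> S" for g g'
  proof (rule LIMSEQ_unique)
    show "(\<lambda>n. m (F n) (g, g')) \<longlonglongrightarrow> inner k g"
      unfolding m_def by (simp, intro tendsto_intros k)
    show "(\<lambda>n. m (F n) (g, g')) \<longlonglongrightarrow> inner h g'"
      using lim[OF g] by simp
  qed
  have "(h, k) \<in> S"
    by (rule nonneg_selfadjoint_iff[OF S, THEN iffD2]) (use kg in auto)
  moreover have "(norm k)\<^sup>2 \<le> c"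
  proof -
    \<comment> \<open>\<open>k\<close> is a limit of vectors of the domain of \<open>S\<close>, so
      the bound may be evaluated at \<open>k\<close> itself.\<close>
    have "(inner k (fst (F n)))\<^sup>2 \<le> c * inner (fst (F n)) (fst (F n))" for n
      using kg[of "fst (F n)" "snd (F n)"] h_bound[of "fst (F n)" "snd (F n)"] F[of n] by simp
    then have "(inner k k)\<^sup>2 \<le> c * inner k k"
      by (intro LIMSEQ_le[OF tendsto_power[OF tendsto_inner[OF tendsto_const k]]
            tendsto_mult[OF tendsto_const tendsto_inner[OF k k]]]) blast
    then have "inner k k \<le> c"
      using \<open>0 \<le> c\<close> by (cases "k = 0") (simp_all add: power2_eq_square)
    then show ?thesis
      by (simp add: power2_norm_eq_inner)
  qed
  ultimately show thesis
    using that by blast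
qed

section \<open>The Krein--von Neumann extension\<close>

text \<open>On the graph of V this is the form <f, V g>. Taking pairs as arguments makes it bilinear
  on the whole space, as the form lemmas require.\<close>

definition graph_form :: "'h::chilbert_space \<times> 'h \<Rightarrow> 'h \<times> 'h \<Rightarrow> real" where
  "graph_form p q = inner (fst p) (snd q)"

lemma bilinear_graph_form: "bilinear graph_form"
  unfolding bilinear_def
  by (intro conjI allI linearI) (simp_all add: graph_form_def inner_add_left inner_add_right)

text \<open>The description of the extension by Ando and Nishio.\<close>

definition krein_op :: "'h::chilbert_space op \<Rightarrow> 'h op" where
  "krein_op V = {(x, w). (x, w) \<in> adjoint_op V \<and>
     (\<exists>F e. (\<forall>n. F n \<in> V) \<and> (\<lambda>n. snd (F n)) \<longlonglongrightarrow> w \<and> e \<longlonglongrightarrow> 0 \<and>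
       (\<forall>i j. graph_form (F i - F j) (F i - F j) \<le> e i + e j))}"

lemma krein_op_iff:
  "(x, w) \<in> krein_op V \<longleftrightarrow> (x, w) \<in> adjoint_op V \<and>
     (\<exists>F e. (\<forall>n. F n \<in> V) \<and> (\<lambda>n. snd (F n)) \<longlonglongrightarrow> w \<and> e \<longlonglongrightarrow> 0 \<and>
       (\<forall>i j. graph_form (F i - F j) (F i - F j) \<le> e i + e j))"
  by (simp add: krein_op_def)

lemma krein_opI:
  assumes "(x, w) \<in> adjoint_op V" "\<And>n. F n \<in> V" "(\<lambda>n. snd (F n)) \<longlonglongrightarrow> w" "e \<longlonglongrightarrow> 0"
    "\<And>i j. graph_form (F i - F j) (F i - F j) \<le> e i + e j"
  shows "(x, w) \<in> krein_op V"
  using assms unfolding krein_op_iff by blast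

locale nonneg_symmetric =
  fixes V :: "'h::chilbert_space op"
  assumes csub: "csubspace V" and dense: "closure (Domain V) = UNIV"
    and sym: "\<And>p q. p \<in> V \<Longrightarrow> q \<in> V \<Longrightarrow> graph_form p q = graph_form q p"
    and nonneg: "\<And>p. p \<in> V \<Longrightarrow> 0 \<le> graph_form p p"
begin

lemmas sub = csubspace_imp_subspace[OF csub]
lemmas bil = bilinear_ladd[OF bilinear_graph_form] bilinear_radd[OF bilinear_graph_form]
  bilinear_lsub[OF bilinear_graph_form] bilinear_rsub[OF bilinear_graph_form]

lemma adjoint_graph_form:
  "(x, w) \<in> adjoint_op V \<Longrightarrow> p \<in> V \<Longrightarrow> inner x (snd p) = inner w (fst p)"
  using adjoint_op_iff_inner[OF csub] by (cases p) auto

lemma graph_form_cauchy_schwarz: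
  "p \<in> V \<Longrightarrow> q \<in> V \<Longrightarrow> (graph_form p q)\<^sup>2 \<le> graph_form p p * graph_form q q"
  by (rule form_cauchy_schwarz[OF bilinear_graph_form sub sym nonneg])

lemma graph_form_add_le:
  assumes "p \<in> V" "q \<in> V"
  shows "graph_form (p + q) (p + q) \<le> 2 * graph_form p p + 2 * graph_form q q"
  using nonneg[OF subspace_diff[OF sub assms]] by (simp add: bil)

lemma subset_krein_op: "V \<subseteq> krein_op V"
proof clarify
  fix x y assume xy: "(x, y) \<in> V"
  show "(x, y) \<in> krein_op V"
  proof (rule krein_opI[where F = "\<lambda>_. (x, y)" and e = "\<lambda>_. 0"])
    show "(x, y) \<in> adjoint_op V"
      using sym[OF xy] by (auto simp: adjoint_op_iff_inner[OF csub] graph_form_def inner_commute)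
  qed (use xy in \<open>simp_all add: graph_form_def\<close>)
qed

lemma csubspace_krein_op: "csubspace (krein_op V)"
proof (rule complex_vector.subspaceI)
  show "0 \<in> krein_op V"
    using subset_krein_op complex_vector.subspace_0[OF csub] by blast
next
  fix p p' assume "p \<in> krein_op V" "p' \<in> krein_op V"
  moreover obtain x w x' w' where p: "p = (x, w)" "p' = (x', w')"
    by fastforce
  ultimately have xw: "(x, w) \<in> krein_op V" "(x', w') \<in> krein_op V"
    by simp_all
  obtain F e where F: "(x, w) \<in> adjoint_op V" "\<And>n. F n \<in> V" "(\<lambda>n. snd (F n)) \<longlonglongrightarrow> w" "e \<longlonglongrightarrow> 0"
    "\<And>i j. graph_form (F i - F j) (F i - F j) \<le> e i + e j"
    using xw(1) unfolding krein_op_iff by blast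
  obtain F' e' where F': "(x', w') \<in> adjoint_op V" "\<And>n. F' n \<in> V" "(\<lambda>n. snd (F' n)) \<longlonglongrightarrow> w'"
    "e' \<longlonglongrightarrow> 0" "\<And>i j. graph_form (F' i - F' j) (F' i - F' j) \<le> e' i + e' j"
    using xw(2) unfolding krein_op_iff by blast
  \<comment> \<open>The factors 2 in the error sequence come from
    \<open>graph_form_add_le\<close>.\<close>
  have "(x + x', w + w') \<in> krein_op V"
  proof (rule krein_opI[where F = "\<lambda>n. F n + F' n" and e = "\<lambda>n. 2 * e n + 2 * e' n"])
    show "(x + x', w + w') \<in> adjoint_op V"
      using F(1) F'(1) by (fastforce simp: adjoint_op_def cinner_add_left)
    show "F n + F' n \<in> V" for n
      by (intro subspace_add[OF sub] F F')
    show "(\<lambda>n. snd (F n + F' n)) \<longlonglongrightarrow> w + w'"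
      unfolding snd_add by (intro tendsto_add F F')
    show "(\<lambda>n. 2 * e n + 2 * e' n) \<longlonglongrightarrow> 0"
      using tendsto_add[OF tendsto_mult_right_zero[OF F(4), of 2]
          tendsto_mult_right_zero[OF F'(4), of 2]]
      by simp
    show "graph_form (F i + F' i - (F j + F' j)) (F i + F' i - (F j + F' j))
        \<le> 2 * e i + 2 * e' i + (2 * e j + 2 * e' j)" for i j
      using graph_form_add_le[OF subspace_diff[OF sub F(2)[of i] F(2)[of j]]
          subspace_diff[OF sub F'(2)[of i] F'(2)[of j]]] F(5)[of i j] F'(5)[of i j]
      by (simp add: algebra_simps)
  qed
  then show "p + p' \<in> krein_op V"
    by (simp add: p)
next
  fix c p assume "p \<in> krein_op V"
  moreover obtain x w where p: "p = (x, w)"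
    by fastforce
  ultimately have xw: "(x, w) \<in> krein_op V"
    by simp
  obtain F e where F: "(x, w) \<in> adjoint_op V" "\<And>n. F n \<in> V" "(\<lambda>n. snd (F n)) \<longlonglongrightarrow> w" "e \<longlonglongrightarrow> 0"
    "\<And>i j. graph_form (F i - F j) (F i - F j) \<le> e i + e j"
    using xw unfolding krein_op_iff by blast
  have scale: "graph_form (c *\<^sub>C q) (c *\<^sub>C q) = (cmod c)\<^sup>2 * graph_form q q" for q :: "'h \<times> 'h"
  proof -
    have "graph_form (c *\<^sub>C q) (c *\<^sub>C q) = inner (fst q) ((cnj c * c) *\<^sub>C snd q)"
      by (simp add: graph_form_def scaleC_prod_def inner_scaleC_left scaleC_scaleC)
    also have "(cnj c * c) *\<^sub>C snd q = (cmod c)\<^sup>2 *\<^sub>R snd q"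
      by (metis complex_norm_square mult.commute scaleC_of_real)
    finally show ?thesis
      by (simp add: graph_form_def)
  qed
  have "(c *\<^sub>C x, c *\<^sub>C w) \<in> krein_op V"
  proof (rule krein_opI[where F = "\<lambda>n. c *\<^sub>C F n" and e = "\<lambda>n. (cmod c)\<^sup>2 * e n"])
    show "(c *\<^sub>C x, c *\<^sub>C w) \<in> adjoint_op V"
      using F(1) by (fastforce simp: adjoint_op_def cinner_scaleC_left)
    show "c *\<^sub>C F n \<in> V" for n
      by (intro complex_vector.subspace_scale[OF csub] F)
    show "(\<lambda>n. snd (c *\<^sub>C F n)) \<longlonglongrightarrow> c *\<^sub>C w"
      unfolding scaleC_prod_def snd_conv by (intro bounded_linear.tendsto[OF bounded_linear_scaleC] F)
    show "graph_form (c *\<^sub>C F i - c *\<^sub>C F j) (c *\<^sub>C F i - c *\<^sub>C F j)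
        \<le> (cmod c)\<^sup>2 * e i + (cmod c)\<^sup>2 * e j"
      for i j
      using mult_left_mono[OF F(5)[of i j] zero_le_power2[of "cmod c"]]
      by (simp add: scale algebra_simps flip: complex_vector.scale_right_diff_distrib)
  qed (use tendsto_mult_right_zero[OF F(4)] in blast)
  then show "c *\<^sub>C p \<in> krein_op V"
    by (simp add: p scaleC_prod_def)
qed

text \<open>The first components f_n of the approximating sequence need not converge, so the form is
  reached through cross terms: <V f_m, f_n> tends to <w, f_n> in m, the adjoint relation turns this
  into <x, V f_n>, and n tends to infinity last.\<close>

lemma krein_op_form_bound:
  assumes xw: "(x, w) \<in> krein_op V" and "0 \<le> c"
    and bound: "\<And>p. p \<in> V \<Longrightarrow> (inner h (snd p))\<^sup>2 \<le> c * graph_form p p"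
  shows "(inner h w)\<^sup>2 \<le> c * inner x w"
proof -
  obtain F e where adj: "(x, w) \<in> adjoint_op V" and F: "\<And>n. F n \<in> V"
    and w: "(\<lambda>n. snd (F n)) \<longlonglongrightarrow> w" and e: "e \<longlonglongrightarrow> 0"
    and form: "\<And>i j. graph_form (F i - F j) (F i - F j) \<le> e i + e j"
    using xw unfolding krein_op_iff by blast
  define s where "s n = (inner h (snd (F n)))\<^sup>2" for n
  have s: "s \<longlonglongrightarrow> (inner h w)\<^sup>2"
    unfolding s_def by (intro tendsto_intros w)
  have le: "s m + s n - c * (e m + e n) \<le> 2 * c * inner (snd (F m)) (fst (F n))" for m n
  proof -
    have "graph_form (F m) (F m) + graph_form (F n) (F n) - 2 * graph_form (F n) (F m)
        = graph_form (F m - F n) (F m - F n)"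
      using sym[OF F F, of m n] by (simp add: bil)
    also have "\<dots> \<le> e m + e n"
      by (rule form)
    finally have "c * (graph_form (F m) (F m) + graph_form (F n) (F n) - 2 * graph_form (F n) (F m))
        \<le> c * (e m + e n)"
      using \<open>0 \<le> c\<close> by (intro mult_left_mono)
    then show ?thesis
      using bound[OF F[of m]] bound[OF F[of n]]
      by (simp add: s_def algebra_simps graph_form_def inner_commute)
  qed
  have "(inner h w)\<^sup>2 + s n - c * (0 + e n) \<le> 2 * c * inner w (fst (F n))" for n
    by (rule LIMSEQ_le[of "\<lambda>m. s m + s n - c * (e m + e n)" _
          "\<lambda>m. 2 * c * inner (snd (F m)) (fst (F n))"])
      (intro tendsto_intros s e w, intro tendsto_intros w, use le in blast)
  then have le2: "(inner h w)\<^sup>2 + s n - c * (0 + e n) \<le> 2 * c * inner x (snd (F n))" for n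
    using adjoint_graph_form[OF adj F[of n]] by simp
  have "(inner h w)\<^sup>2 + (inner h w)\<^sup>2 - c * (0 + 0) \<le> 2 * c * inner x w"
    by (rule LIMSEQ_le[of "\<lambda>n. (inner h w)\<^sup>2 + s n - c * (0 + e n)" _
          "\<lambda>n. 2 * c * inner x (snd (F n))"])
      (intro tendsto_intros s e, intro tendsto_intros w, use le2 in blast)
  then show ?thesis
    by simp
qed

text \<open>For fixed second argument the form tends to <w, f'_n> = <x, V f'_n>. By Cauchy-Schwarz
  the error is at most e n * M for all second arguments at once, which permits passing to the
  diagonal.\<close>

lemma krein_op_form_tendsto:
  assumes adj: "(x, w) \<in> adjoint_op V" and F: "\<And>n. F n \<in> V" and w: "(\<lambda>n. snd (F n)) \<longlonglongrightarrow> w"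
    and e: "e \<longlonglongrightarrow> 0" and form: "\<And>i j. graph_form (F i - F j) (F i - F j) \<le> e i + e j"
    and F': "\<And>n. F' n \<in> V" and w': "(\<lambda>n. snd (F' n)) \<longlonglongrightarrow> w'"
    and e': "e' \<longlonglongrightarrow> 0" and form': "\<And>i j. graph_form (F' i - F' j) (F' i - F' j) \<le> e' i + e' j"
  shows "(\<lambda>n. graph_form (F n) (F' n)) \<longlonglongrightarrow> inner x w'"
proof -
  obtain K where K: "\<And>n. \<bar>e' n\<bar> \<le> K"
    using convergent_imp_Bseq[OF convergentI[OF e']] unfolding Bseq_def by auto
  \<comment> \<open>Comparison of \<open>F' n\<close> with \<open>F' 0\<close> by
    \<open>graph_form_add_le\<close>: its first term is at most 2 (e' n + e' 0), hence at most 4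
    K.\<close>
  define M where "M = 4 * K + 2 * graph_form (F' 0) (F' 0)"
  have M: "graph_form (F' n) (F' n) \<le> M" for n
  proof -
    have "graph_form (F' n) (F' n) \<le> 2 * (e' n + e' 0) + 2 * graph_form (F' 0) (F' 0)"
      using graph_form_add_le[OF subspace_diff[OF sub F'[of n] F'[of 0]] F'[of 0]] form'[of n 0]
      by simp
    then show ?thesis
      using K[of n] K[of 0] by (simp add: M_def)
  qed
  have "(inner x (snd (F' n)) - graph_form (F n) (F' n))\<^sup>2 \<le> e n * M" for n
  proof -
    have le: "(graph_form (F m) (F' n) - graph_form (F n) (F' n))\<^sup>2 \<le> (e m + e n) * M" for m
    proof -
      have "(graph_form (F m - F n) (F' n))\<^sup>2
          \<le> graph_form (F m - F n) (F m - F n) * graph_form (F' n) (F' n)"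
        by (intro graph_form_cauchy_schwarz subspace_diff[OF sub] F F')
      also have "\<dots> \<le> (e m + e n) * M"
        using nonneg[OF subspace_diff[OF sub F[of m] F[of n]]] form[of m n] nonneg[OF F', of n] M[of n]
        by (intro mult_mono) linarith+
      finally show ?thesis
        by (simp add: bil)
    qed
    have "(\<lambda>m. graph_form (F m) (F' n)) \<longlonglongrightarrow> inner w (fst (F' n))"
      unfolding sym[OF F F'] unfolding graph_form_def
      by (subst inner_commute) (intro tendsto_intros w)
    then have lim: "(\<lambda>m. graph_form (F m) (F' n)) \<longlonglongrightarrow> inner x (snd (F' n))"
      by (simp add: adjoint_graph_form[OF adj F'])
    have "(inner x (snd (F' n)) - graph_form (F n) (F' n))\<^sup>2 \<le> (0 + e n) * M"
      by (rule LIMSEQ_le[of "\<lambda>m. (graph_form (F m) (F' n) - graph_form (F n) (F' n))\<^sup>2" _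
            "\<lambda>m. (e m + e n) * M"])
        (intro tendsto_intros lim, intro tendsto_intros e, use le in blast)
    then show ?thesis
      by simp
  qed
  then have "(\<lambda>n. (inner x (snd (F' n)) - graph_form (F n) (F' n))\<^sup>2) \<longlonglongrightarrow> 0"
    by (intro tendsto_sandwich[OF _ _ tendsto_const tendsto_mult_left_zero[OF e, of M]]) simp_all
  then have "(\<lambda>n. inner x (snd (F' n)) - graph_form (F n) (F' n)) \<longlonglongrightarrow> 0"
    by simp
  then have "(\<lambda>n. inner x (snd (F' n)) - (inner x (snd (F' n)) - graph_form (F n) (F' n)))
      \<longlonglongrightarrow> inner x w' - 0"
    by (intro tendsto_intros w')
  then show ?thesis
    by simp
qed

text \<open>Both sides are limits of the same diagonal sequence of form values.\<close>

lemma krein_op_sym: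
  assumes xw: "(x, w) \<in> krein_op V" and xw': "(x', w') \<in> krein_op V"
  shows "inner x w' = inner w x'"
proof -
  obtain F e where F: "(x, w) \<in> adjoint_op V" "\<And>n. F n \<in> V" "(\<lambda>n. snd (F n)) \<longlonglongrightarrow> w" "e \<longlonglongrightarrow> 0"
    "\<And>i j. graph_form (F i - F j) (F i - F j) \<le> e i + e j"
    using xw unfolding krein_op_iff by blast
  obtain F' e' where F': "(x', w') \<in> adjoint_op V" "\<And>n. F' n \<in> V" "(\<lambda>n. snd (F' n)) \<longlonglongrightarrow> w'"
    "e' \<longlonglongrightarrow> 0" "\<And>i j. graph_form (F' i - F' j) (F' i - F' j) \<le> e' i + e' j"
    using xw' unfolding krein_op_iff by blast
  have "(\<lambda>n. graph_form (F n) (F' n)) \<longlonglongrightarrow> inner x w'"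
    by (rule krein_op_form_tendsto[OF F F'(2-)])
  moreover have "(\<lambda>n. graph_form (F n) (F' n)) \<longlonglongrightarrow> inner x' w"
    using krein_op_form_tendsto[OF F' F(2-)] by (simp add: sym[OF F(2) F'(2)])
  ultimately show ?thesis
    using LIMSEQ_unique by (metis inner_commute)
qed

text \<open>The value of \<open>(1 + krein_op V)\<^sup>-\<^sup>1\<close> at \<open>z\<close> is the limit of \<open>z - V f\<close> along a minimising sequence
  of \<open>(norm (z - V f))\<^sup>2 + inner f (V f)\<close>.\<close>

lemma krein_op_resolvent:
  obtains x w where "(x, w) \<in> krein_op V" "z = x + w"
proof -
  define m where "m p q = inner (snd p) (snd q) + graph_form p q" for p q :: "'h \<times> 'h"
  have bil_m: "bilinear m"
    unfolding bilinear_def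
    by (intro conjI allI linearI)
      (simp_all add: m_def graph_form_def inner_add_left inner_add_right algebra_simps)
  have lin: "linear (\<lambda>p. inner z (snd p))"
    by (intro linearI) (simp_all add: inner_add_right)
  have sym_m: "m p q = m q p" if "p \<in> V" "q \<in> V" for p q
    using sym[OF that] by (simp add: m_def inner_commute)
  have ge: "(norm (snd p))\<^sup>2 \<le> m p p" "graph_form p p \<le> m p p" "0 \<le> m p p" if "p \<in> V" for p
    using nonneg[OF that] by (simp_all add: m_def power2_norm_eq_inner)
  have bound: "(inner z (snd f))\<^sup>2 \<le> inner z z * m f f" if "f \<in> V" for f
  proof -
    have "(inner z (snd f))\<^sup>2 \<le> inner z z * inner (snd f) (snd f)"
      by (rule Cauchy_Schwarz_ineq)
    also have "\<dots> \<le> inner z z * m f f"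
      using ge(1)[OF that] by (intro mult_left_mono) (simp_all add: power2_norm_eq_inner)
    finally show ?thesis .
  qed
  obtain F e where F: "\<And>n. F n \<in> V" and e: "e \<longlonglongrightarrow> 0"
    and mF: "\<And>i j. m (F i - F j) (F i - F j) \<le> e i + e j"
    and lim: "\<And>g. g \<in> V \<Longrightarrow> (\<lambda>n. m (F n) g) \<longlonglongrightarrow> inner z (snd g)"
    using form_riesz[OF bil_m sub sym_m ge(3) lin bound] by blast
  note diff = subspace_diff[OF sub F F]
  have "Cauchy (\<lambda>n. snd (F n))"
    by (rule Cauchy_if_square_dist_le[OF e]) (use order_trans[OF ge(1)[OF diff] mF] in simp)
  then obtain w where w: "(\<lambda>n. snd (F n)) \<longlonglongrightarrow> w"
    by (meson Cauchy_convergent convergentD)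
  have "(z - w, w) \<in> adjoint_op V"
    unfolding adjoint_op_iff_inner[OF csub]
  proof clarify
    fix f g assume fg: "(f, g) \<in> V"
    have "inner w g + inner w f = inner z g"
    proof (rule LIMSEQ_unique)
      have "m (F n) (f, g) = inner (snd (F n)) g + inner (snd (F n)) f" for n
        using sym[OF F fg, of n] by (simp add: m_def graph_form_def inner_commute)
      then show "(\<lambda>n. m (F n) (f, g)) \<longlonglongrightarrow> inner w g + inner w f"
        by (simp, intro tendsto_intros w)
      show "(\<lambda>n. m (F n) (f, g)) \<longlonglongrightarrow> inner z g"
        using lim[OF fg] by simp
    qed
    then show "inner (z - w) g = inner w f"
      by (simp add: inner_diff_left)
  qed
  then have "(z - w, w) \<in> krein_op V"
    by (rule krein_opI[OF _ F w e order_trans[OF ge(2)[OF diff] mF]])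
  then show thesis
    using that by simp
qed

lemma nonneg_selfadjoint_krein_op: "nonneg_selfadjoint (krein_op V)"
proof (rule nonneg_selfadjointI[OF csubspace_krein_op])
  show "closure (Domain (krein_op V)) = UNIV"
    using closure_mono[OF Domain_mono[OF subset_krein_op]] dense by blast
  show "inner x y' = inner y x'" if "(x, y) \<in> krein_op V" "(x', y') \<in> krein_op V" for x y x' y'
    by (rule krein_op_sym[OF that])
  \<comment> \<open>The form bound for h = 0 and c = 1.\<close>
  show "0 \<le> inner x y" if "(x, y) \<in> krein_op V" for x y
    using krein_op_form_bound[OF that, of 1 0] nonneg by simp
  show "(g, h) \<in> krein_op V" if gh: "\<And>x y. (x, y) \<in> krein_op V \<Longrightarrow> inner g y = inner h x" for g h
  proof -
    \<comment> \<open>A symmetric operator K with 1 + K onto is selfadjoint: g - x is orthogonal to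
      the range of 1 + K, and it lies in that range by the second use of the resolvent.\<close>
    obtain x w where xw: "(x, w) \<in> krein_op V" "g + h = x + w"
      by (rule krein_op_resolvent)
    obtain y u where yu: "(y, u) \<in> krein_op V" "g - x = y + u"
      by (rule krein_op_resolvent)
    have "inner (g - x) (y + u) = inner (g + h) y - inner (x + w) y"
      using gh[OF yu(1)] krein_op_sym[OF xw(1) yu(1)]
      by (simp add: inner_add_left inner_add_right inner_diff_left)
    then have "inner (g - x) (g - x) = 0"
      by (simp add: xw(2) yu(2))
    then have "g = x"
      by simp
    then show ?thesis
      using xw by simp
  qed
qed

section \<open>Form domain and minimality of the extension\<close>

lemma in_sqrt_domain_krein_op:
  assumes "0 \<le> c" and bound: "\<And>p. p \<in> V \<Longrightarrow> (inner h (snd p))\<^sup>2 \<le> c * graph_form p p"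
  obtains k where "(h, k) \<in> op_sqrt (krein_op V)" "(norm k)\<^sup>2 \<le> c"
proof (rule in_sqrt_domain_if_form_bound[OF
      nonneg_selfadjoint_op_sqrt[OF nonneg_selfadjoint_krein_op] assms(1)])
  show "(inner h w)\<^sup>2 \<le> c * inner y w" if "(y, w) \<in> op_sqrt (krein_op V) O op_sqrt (krein_op V)" for y w
    using that krein_op_form_bound[OF _ assms]
    by (simp add: op_sqrt_square[OF nonneg_selfadjoint_krein_op])
qed

text \<open>If h lies in the domain of the root S' of V', Cauchy-Schwarz gives <h, V f>^2 = <S' h,
  S' f>^2 <= |S' h|^2 <f, V f>, which is the bound that \<open>in_sqrt_domain_krein_op\<close> asks
  for.\<close>

lemma krein_op_least:
  assumes V': "nonneg_selfadjoint V'" and ext: "V \<subseteq> V'"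
  shows "op_le (krein_op V) V'"
proof -
  let ?S = "op_sqrt (krein_op V)" and ?S' = "op_sqrt V'"
  note S = nonneg_selfadjoint_op_sqrt[OF nonneg_selfadjoint_krein_op]
  note S' = nonneg_selfadjoint_op_sqrt[OF V']
  have "h \<in> Domain ?S \<and> norm (?S \<cdot> h) \<le> norm (?S' \<cdot> h)" if "h \<in> Domain ?S'" for h
  proof -
    define k where "k = ?S' \<cdot> h"
    have hk: "(h, k) \<in> ?S'"
      unfolding k_def by (rule op_apply_mem[OF nonneg_selfadjoint_single_valued[OF S'] that])
    have "(inner h (snd p))\<^sup>2 \<le> (norm k)\<^sup>2 * graph_form p p" if "p \<in> V" for p
    proof -
      have "p \<in> ?S' O ?S'"
        using that ext op_sqrt_square[OF V'] by blast
      then obtain f u g where p: "p = (f, g)" and fu: "(f, u) \<in> ?S'" and ug: "(u, g) \<in> ?S'"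
        by blast
      have "(inner h g)\<^sup>2 = (inner k u)\<^sup>2"
        using nonneg_selfadjoint_sym[OF S' hk ug] by simp
      also have "\<dots> \<le> inner k k * inner u u"
        by (rule Cauchy_Schwarz_ineq)
      also have "inner u u = inner f g"
        using nonneg_selfadjoint_sym[OF S' fu ug] by simp
      finally show ?thesis
        by (simp add: p graph_form_def power2_norm_eq_inner)
    qed
    then obtain k' where k': "(h, k') \<in> ?S" "(norm k')\<^sup>2 \<le> (norm k)\<^sup>2"
      by (rule in_sqrt_domain_krein_op[OF zero_le_power2])
    then have "norm k' \<le> norm k"
      by (simp add: power2_le_iff_abs_le)
    then show ?thesis
      using k'(1) op_apply_eq[OF nonneg_selfadjoint_single_valued[OF S] k'(1)] by (auto simp: k_def)
  qed
  then show ?thesis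
    unfolding op_le_def by blast
qed

lemma krein_von_neumann:
  shows nonneg_selfadjoint_krein_von_neumann: "nonneg_selfadjoint (krein_von_neumann V)"
    and subset_krein_von_neumann: "V \<subseteq> krein_von_neumann V"
    and krein_von_neumann_least:
      "nonneg_selfadjoint V' \<Longrightarrow> V \<subseteq> V' \<Longrightarrow> op_le (krein_von_neumann V) V'"
proof -
  have "\<exists>K. nonneg_selfadjoint K \<and> V \<subseteq> K \<and>
      (\<forall>V'. nonneg_selfadjoint V' \<and> V \<subseteq> V' \<longrightarrow> op_le K V')"
    using nonneg_selfadjoint_krein_op subset_krein_op krein_op_least by blast
  from someI_ex[OF this]
  show "nonneg_selfadjoint (krein_von_neumann V)" "V \<subseteq> krein_von_neumann V"
    "nonneg_selfadjoint V' \<Longrightarrow> V \<subseteq> V' \<Longrightarrow> op_le (krein_von_neumann V) V'"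
    unfolding krein_von_neumann_def by blast+
qed

text \<open>The operator picked by choice is below \<open>krein_op V\<close> by its minimality, so
  its form domain is at least as large and its form at most as big.\<close>

lemma in_sqrt_domain_krein_von_neumann:
  assumes "0 \<le> c" and bound: "\<And>p. p \<in> V \<Longrightarrow> (inner h (snd p))\<^sup>2 \<le> c * graph_form p p"
  shows "h \<in> Domain (op_sqrt (krein_von_neumann V))"
    and "(norm (op_sqrt (krein_von_neumann V) \<cdot> h))\<^sup>2 \<le> c"
proof -
  obtain k where k: "(h, k) \<in> op_sqrt (krein_op V)" "(norm k)\<^sup>2 \<le> c"
    using in_sqrt_domain_krein_op[OF assms] by blast
  have "op_sqrt (krein_op V) \<cdot> h = k"
    using nonneg_selfadjoint_op_sqrt[OF nonneg_selfadjoint_krein_op] k(1)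
    by (intro op_apply_eq nonneg_selfadjoint_single_valued)
  moreover have "op_le (krein_von_neumann V) (krein_op V)"
    by (rule krein_von_neumann_least[OF nonneg_selfadjoint_krein_op subset_krein_op])
  ultimately have "h \<in> Domain (op_sqrt (krein_von_neumann V))"
    "norm (op_sqrt (krein_von_neumann V) \<cdot> h) \<le> norm k"
    using k(1) unfolding op_le_def by blast+
  then show "h \<in> Domain (op_sqrt (krein_von_neumann V))"
    "(norm (op_sqrt (krein_von_neumann V) \<cdot> h))\<^sup>2 \<le> c"
    using k(2) by (auto intro: order_trans[OF power_mono])
qed

end

section \<open>Dissipative extensions\<close>

lemma single_valued_adjoint_op:
  fixes T :: "'h::chilbert_space op"
  assumes "densely_defined T"
  shows "single_valued (adjoint_op T)"
proof (rule single_valuedI)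
  fix x y z assume xy: "(x, y) \<in> adjoint_op T" and xz: "(x, z) \<in> adjoint_op T"
  have "y - z = 0"
  proof (rule dense_inner_eq_0)
    show "closure (Domain T) = UNIV"
      using assms by (simp add: densely_defined_def)
    fix u assume "u \<in> Domain T"
    then obtain w where "(u, w) \<in> T"
      by blast
    with xy xz have "cinner y u = cinner z u"
      unfolding adjoint_op_def by fastforce
    then show "inner (y - z) u = 0"
      by (simp add: inner_diff_left) (simp add: inner_eq_Re_cinner)
  qed
  then show "y = z"
    by simp
qed

lemma Im_cinner_eq_inner: "Im (cinner x y) = inner x ((- \<i>) *\<^sub>C y)"
  by (simp only: cinner_eq_inner complex.sel)

theorem lemma5p1:
  fixes A At V VK AV :: "'h::chilbert_space op"
    and D N W :: "'h set"
    and q :: "'h \<Rightarrow> real"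
  assumes "dual_pair A At" and "closed_operator A" and "closed_operator At"
    and "common_core_property A At"
    and "dissipative A"
    and "common_core A At D"
    and V_eq: "V = imaginary_part_on A At D"
    and VK_eq: "VK = krein_von_neumann V"
    and N: "is_complement (Domain (adjoint_op At)) (Domain A) N"
    and W: "csubspace W" "W \<subseteq> N"
    and AV_eq: "AV = ext_by A At W"
    and AV: "proper_extension A At AV" "dissipative AV"
    and q_eq: "\<And>v. v \<in> W \<Longrightarrow>
      q v = Im (cinner v (adjoint_op At \<cdot> v)) - (norm (op_sqrt VK \<cdot> v))\<^sup>2"
  shows "\<forall>f \<in> Domain A. \<forall>v \<in> W.
    f + v \<in> Domain (op_sqrt VK) \<and>
    Im (cinner (f + v) (AV \<cdot> (f + v))) = (norm (op_sqrt VK \<cdot> (f + v)))\<^sup>2 + q v \<and>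
    (norm (op_sqrt VK \<cdot> (f + v)))\<^sup>2 + q v \<ge> (norm (op_sqrt VK \<cdot> (f + v)))\<^sup>2"
proof -
  let ?G = "adjoint_op At"
  have At: "densely_defined At" and svA: "single_valued A" and svAt: "single_valued At"
    and csubA: "csubspace A" and csubAt: "csubspace At" and denseA: "closure (Domain A) = UNIV"
    and AG: "A \<subseteq> ?G"
    using \<open>dual_pair A At\<close> by (auto simp: dual_pair_def densely_defined_def is_operator_def)
  have csubD: "csubspace D" and D: "D \<subseteq> Domain A" "D \<subseteq> Domain At"
    and core: "A = closure (op_restrict A D)"
    using \<open>common_core A At D\<close> by (auto simp: common_core_def)
  note svG = single_valued_adjoint_op[OF At]
  have svAV: "single_valued AV" and csubAV: "csubspace AV"
    using AV(1) by (simp_all add: proper_extension_def is_operator_def)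
  have adj: "cinner g y = cinner h x" if "(g, h) \<in> ?G" "(x, y) \<in> At" for g h x y
    using that by (fastforce simp: adjoint_op_def)
  \<comment> \<open>V in terms of the values y and y' of \<open>A\<close> and \<open>At\<close> at
    one point, which lets the proof argue with points of the graphs.\<close>
  define Vg where "Vg y y' = (1 / (2 * \<i>)) *\<^sub>C (y - y')" for y y' :: 'h
  have V_iff: "p \<in> V \<longleftrightarrow> (\<exists>f y y'. p = (f, Vg y y') \<and> f \<in> D \<and> (f, y) \<in> A \<and> (f, y') \<in> At)" for p
  proof
    assume "p \<in> V"
    then obtain f where f: "p = (f, Vg (A \<cdot> f) (At \<cdot> f))" "f \<in> D"
      unfolding V_eq imaginary_part_on_def Vg_def by blast
    moreover have "(f, A \<cdot> f) \<in> A" "(f, At \<cdot> f) \<in> At"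
      using D f(2) by (auto intro: op_apply_mem[OF svA] op_apply_mem[OF svAt])
    ultimately show "\<exists>f y y'. p = (f, Vg y y') \<and> f \<in> D \<and> (f, y) \<in> A \<and> (f, y') \<in> At"
      by blast
  next
    assume "\<exists>f y y'. p = (f, Vg y y') \<and> f \<in> D \<and> (f, y) \<in> A \<and> (f, y') \<in> At"
    then obtain f y y' where f: "p = (f, Vg y y')" "f \<in> D" "(f, y) \<in> A" "(f, y') \<in> At"
      by blast
    then have "p = (f, Vg (A \<cdot> f) (At \<cdot> f))"
      by (simp add: op_apply_eq[OF svA] op_apply_eq[OF svAt])
    then show "p \<in> V"
      using f(2) unfolding V_eq imaginary_part_on_def Vg_def by blast
  qed
  have Re_half: "Re (1 / (2 * \<i>) * (a - b)) = (Im a - Im b) / 2" for a b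
    by (simp only: times_complex.sel) (simp add: Re_divide Im_divide power2_eq_square)
  have inner_Vg: "inner h (Vg y y') = (Im (cinner h y) - Im (cinner h y')) / 2" for h y y'
  proof -
    have "cinner h (y - y') = cinner h y - cinner h y'"
      by (metis add_diff_cancel_right' cinner_add_right diff_add_cancel)
    then show ?thesis
      by (simp only: Vg_def inner_eq_Re_cinner cinner_scaleC_right Re_half)
  qed
  \<comment> \<open>The dual pair relation makes <f, At f> the conjugate of <f, A f>.\<close>
  have V_form: "inner f (Vg y y') = Im (cinner f y)" if "(f, y) \<in> A" "(f, y') \<in> At" for f y y'
  proof -
    have "cinner f y' = cnj (cinner f y)"
      using adj[of f y f y'] AG that cinner_commute[of y f] by auto
    then show ?thesis
      by (simp add: inner_Vg)
  qed
  interpret V: nonneg_symmetric V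
  proof
    show "csubspace V"
    proof (rule complex_vector.subspaceI)
      show "0 \<in> V"
        using complex_vector.subspace_0[OF csubD] complex_vector.subspace_0[OF csubA]
          complex_vector.subspace_0[OF csubAt]
        by (auto simp: V_iff Vg_def zero_prod_def intro!: exI[of _ 0])
      show "p + p' \<in> V" if pV: "p \<in> V" "p' \<in> V" for p p'
      proof -
        obtain f y y' where p: "p = (f, Vg y y')" "f \<in> D" "(f, y) \<in> A" "(f, y') \<in> At"
          using pV(1) unfolding V_iff by blast
        obtain g z z' where p': "p' = (g, Vg z z')" "g \<in> D" "(g, z) \<in> A" "(g, z') \<in> At"
          using pV(2) unfolding V_iff by blast
        have "p + p' = (f + g, Vg (y + z) (y' + z'))"
          by (simp add: p(1) p'(1) Vg_def add_diff_add scaleC_add_right)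
        moreover have "f + g \<in> D" "(f + g, y + z) \<in> A" "(f + g, y' + z') \<in> At"
          using complex_vector.subspace_add[OF csubD p(2) p'(2)]
            complex_vector.subspace_add[OF csubA p(3) p'(3)]
            complex_vector.subspace_add[OF csubAt p(4) p'(4)] by simp_all
        ultimately show ?thesis
          unfolding V_iff by blast
      qed
      show "c *\<^sub>C p \<in> V" if pV: "p \<in> V" for c p
      proof -
        obtain f y y' where p: "p = (f, Vg y y')" "f \<in> D" "(f, y) \<in> A" "(f, y') \<in> At"
          using pV unfolding V_iff by blast
        have "c *\<^sub>C p = (c *\<^sub>C f, Vg (c *\<^sub>C y) (c *\<^sub>C y'))"
          by (simp add: p(1) Vg_def scaleC_prod_def scaleC_scaleC mult.commute
              flip: complex_vector.scale_right_diff_distrib)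
        moreover have "c *\<^sub>C f \<in> D" "(c *\<^sub>C f, c *\<^sub>C y) \<in> A" "(c *\<^sub>C f, c *\<^sub>C y') \<in> At"
          using complex_vector.subspace_scale[OF csubD p(2), of c]
            complex_vector.subspace_scale[OF csubA p(3), of c]
            complex_vector.subspace_scale[OF csubAt p(4), of c] by (simp_all add: scaleC_prod_def)
        ultimately show ?thesis
          unfolding V_iff by blast
      qed
    qed
    have "Domain A \<subseteq> closure D"
    proof
      fix f assume "f \<in> Domain A"
      then obtain y where "(f, y) \<in> closure (op_restrict A D)"
        using core by blast
      then obtain p where p: "\<And>n. p n \<in> op_restrict A D" "p \<longlonglongrightarrow> (f, y)"
        unfolding closure_sequential by blast
      have "fst (p n) \<in> D" for n
        using p(1)[of n] by (auto simp: op_restrict_def)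
      moreover have "(\<lambda>n. fst (p n)) \<longlonglongrightarrow> f"
        using tendsto_fst[OF p(2)] by simp
      ultimately show "f \<in> closure D"
        unfolding closure_sequential by (intro exI[of _ "\<lambda>n. fst (p n)"]) blast
    qed
    moreover have "D \<subseteq> Domain V"
      using D V_iff by fast
    ultimately show "closure (Domain V) = UNIV"
      using denseA closure_mono closure_minimal[OF _ closed_closure]
      by (metis top.extremum_unique order_trans)
    show "graph_form p p' = graph_form p' p" if pV: "p \<in> V" "p' \<in> V" for p p'
    proof -
      obtain f y y' where p: "p = (f, Vg y y')" "(f, y) \<in> A" "(f, y') \<in> At"
        using pV(1) unfolding V_iff by blast
      obtain g z z' where p': "p' = (g, Vg z z')" "(g, z) \<in> A" "(g, z') \<in> At"
        using pV(2) unfolding V_iff by blast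
      have "cinner f z' = cnj (cinner g y)" "cinner g y' = cnj (cinner f z)"
        using adj[of f y g z'] adj[of g z f y'] p(2,3) p'(2,3) AG cinner_commute[of y g]
          cinner_commute[of z f] by auto
      then show ?thesis
        by (simp add: p(1) p'(1) graph_form_def inner_Vg)
    qed
    show "0 \<le> graph_form p p" if pV: "p \<in> V" for p
    proof -
      obtain f y y' where p: "p = (f, Vg y y')" "(f, y) \<in> A" "(f, y') \<in> At"
        using pV unfolding V_iff by blast
      then show ?thesis
        using \<open>dissipative A\<close> op_apply_eq[OF svA p(2)]
        by (auto simp: graph_form_def V_form dissipative_def)
    qed
  qed
  let ?S = "op_sqrt VK"
  have VK: "nonneg_selfadjoint VK" "V \<subseteq> VK"
    unfolding VK_eq by (rule V.nonneg_selfadjoint_krein_von_neumann V.subset_krein_von_neumann)+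
  note S = nonneg_selfadjoint_op_sqrt[OF VK(1)]
  note svS = nonneg_selfadjoint_single_valued[OF S]
  note subS = csubspace_imp_subspace[OF nonneg_selfadjoint_csubspace[OF S]]
  have V_sqrt: "\<exists>u. (f, u) \<in> ?S \<and> (u, g) \<in> ?S" if "(f, g) \<in> V" for f g
    using that VK(2) op_sqrt_square[OF VK(1)] by blast
  \<comment> \<open>The graph norm of \<open>A\<close> controls the form of V; this will carry
    convergence on the core over to K^(1/2).\<close>
  have norm_le: "Im (cinner (fst p) (snd p)) \<le> (norm p)\<^sup>2" for p :: "'h \<times> 'h"
  proof -
    have "Im (cinner (fst p) (snd p)) \<le> norm (fst p) * norm (snd p)"
      using norm_cauchy_schwarz[of "fst p" "(- \<i>) *\<^sub>C snd p"]
      unfolding Im_cinner_eq_inner norm_scaleC by simp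
    also have "\<dots> \<le> norm p * norm p"
      by (cases p) (simp add: mult_mono norm_fst_le norm_snd_le)
    finally show ?thesis
      by (simp add: power2_eq_square)
  qed
  show ?thesis
  proof (intro ballI)
    fix f v assume "f \<in> Domain A" and v: "v \<in> W"
    then obtain y where fy: "(f, y) \<in> A"
      by blast
    have G_AV: "(g + v, y + ?G \<cdot> v) \<in> AV" if "(g, y) \<in> A" for g y
    proof -
      have 0: "0 \<in> Domain A"
        using complex_vector.subspace_0[OF csubA] unfolding zero_prod_def by blast
      have "v \<in> Domain ?G"
        using N W(2) v unfolding is_complement_def by (force intro: 0)
      then have "(v, ?G \<cdot> v) \<in> ?G"
        by (rule op_apply_mem[OF svG])
      then have "(g + v, y + ?G \<cdot> v) \<in> ?G"
        using AG that by (fastforce simp: adjoint_op_def cinner_add_left)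
      then show ?thesis
        using that v unfolding AV_eq ext_by_def op_restrict_def by auto
    qed
    have Gv: "(v, ?G \<cdot> v) \<in> ?G"
      using G_AV[of 0 0] complex_vector.subspace_0[OF csubA] AV(1)
      by (auto simp: zero_prod_def proper_extension_def)
    \<comment> \<open>The constant in the form bound for v; \<open>q v\<close> is the excess of
      \<open>Q\<close> over |K^(1/2) v|^2.\<close>
    define Q where "Q = Im (cinner v (?G \<cdot> v))"
    have AV_pos: "0 \<le> Im (cinner (g + v) (y + ?G \<cdot> v))" if "(g, y) \<in> A" for g y
    proof -
      have "g + v \<in> Domain AV"
        using G_AV[OF that] by blast
      then show ?thesis
        using AV(2) op_apply_eq[OF svAV G_AV[OF that]] unfolding dissipative_def by metis
    qed
    \<comment> \<open>The cross terms <v, A g> and <g, At^* v>, the latter conjugate to <v, At g>,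
      have imaginary parts adding up to 2 <v, V g>.\<close>
    have AV_form: "Im (cinner (g + v) (y + ?G \<cdot> v))
        = inner g (Vg y y') + 2 * inner v (Vg y y') + Q" if "(g, y) \<in> A" "(g, y') \<in> At" for g y y'
    proof -
      have "cinner g (?G \<cdot> v) = cnj (cinner v y')"
        using adj[OF Gv that(2)] cinner_commute by metis
      then show ?thesis
        unfolding V_form[OF that] by (simp add: inner_Vg Q_def cinner_add_left cinner_add_right)
    qed
    have Q_nonneg: "0 \<le> Q"
      using AV_pos[of 0 0] AV_form[of 0 0 0] complex_vector.subspace_0[OF csubA]
        complex_vector.subspace_0[OF csubAt] by (simp add: zero_prod_def Vg_def)
    have Q_bound: "(inner v (snd p))\<^sup>2 \<le> Q * graph_form p p" if pV: "p \<in> V" for p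
    proof (rule discriminant_bound)
      fix t :: real
      obtain g z z' where p: "t *\<^sub>R p = (g, Vg z z')" "(g, z) \<in> A" "(g, z') \<in> At"
        using subspace_scale[OF V.sub pV, of t] unfolding V_iff by blast
      have "0 \<le> inner g (Vg z z') + 2 * inner v (Vg z z') + Q"
        using AV_pos[OF p(2)] AV_form[OF p(2,3)] by simp
      moreover have "g = t *\<^sub>R fst p" "Vg z z' = t *\<^sub>R snd p"
        using arg_cong[OF p(1), of fst] arg_cong[OF p(1), of snd] by simp_all
      ultimately show "0 \<le> Q + 2 * t * inner v (snd p) + t\<^sup>2 * graph_form p p"
        by (simp add: graph_form_def power2_eq_square algebra_simps)
    qed (rule V.nonneg[OF pV])
    note vS = V.in_sqrt_domain_krein_von_neumann(1)[OF Q_nonneg Q_bound, folded VK_eq]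
      and v_le = V.in_sqrt_domain_krein_von_neumann(2)[OF Q_nonneg Q_bound, folded VK_eq]
    have Sv: "(v, ?S \<cdot> v) \<in> ?S"
      by (rule op_apply_mem[OF svS vS])
    have "(f, y) \<in> closure (op_restrict A D)"
      using fy core by simp
    then obtain p where p: "\<And>n. p n \<in> op_restrict A D" and lim: "p \<longlonglongrightarrow> (f, y)"
      unfolding closure_sequential by blast
    have "\<exists>y' u. (fst (p n), y') \<in> At \<and> (fst (p n), u) \<in> ?S \<and> (u, Vg (snd (p n)) y') \<in> ?S" for n
    proof -
      have pD: "fst (p n) \<in> D" "(fst (p n), snd (p n)) \<in> A"
        using p[of n] by (auto simp: op_restrict_def)
      then obtain y' where "(fst (p n), y') \<in> At"
        using D(2) by blast
      moreover from this pD have "(fst (p n), Vg (snd (p n)) y') \<in> V"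
        unfolding V_iff by blast
      ultimately show ?thesis
        using V_sqrt by blast
    qed
    then obtain y' u where y': "\<And>n. (fst (p n), y' n) \<in> At" and u: "\<And>n. (fst (p n), u n) \<in> ?S"
      and u': "\<And>n. (u n, Vg (snd (p n)) (y' n)) \<in> ?S"
      by metis
    have pA: "(fst (p n), snd (p n)) \<in> A" for n
      using p[of n] by (auto simp: op_restrict_def)
    have u_norm: "(norm w)\<^sup>2 = Im (cinner g z)"
      if "(g, w) \<in> ?S" "(w, Vg z z') \<in> ?S" "(g, z) \<in> A" "(g, z') \<in> At" for g w z z'
      using nonneg_selfadjoint_sym[OF S that(1,2)] V_form[OF that(3,4)]
      by (simp add: power2_norm_eq_inner)
    \<comment> \<open>For u_n = K^(1/2) f_n, |u_i - u_j|^2 is the form of V, that is the imaginary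
      part of <f, A f>, at the difference f = f_i - f_j of core vectors.\<close>
    have "norm (u i - u j) \<le> norm (p i - p j)" for i j
    proof -
      have "Vg (snd (p i)) (y' i) - Vg (snd (p j)) (y' j) = Vg (snd (p i) - snd (p j)) (y' i - y' j)"
        by (simp add: Vg_def algebra_simps flip: complex_vector.scale_right_diff_distrib)
      then have "(norm (u i - u j))\<^sup>2 = Im (cinner (fst (p i) - fst (p j)) (snd (p i) - snd (p j)))"
        using subspace_diff[OF subS u[of i] u[of j]] subspace_diff[OF subS u'[of i] u'[of j]]
          subspace_diff[OF csubspace_imp_subspace[OF csubA] pA[of i] pA[of j], unfolded diff_Pair]
          subspace_diff[OF csubspace_imp_subspace[OF csubAt] y'[of i] y'[of j]]
        by (intro u_norm[of _ _ _ "y' i - y' j"]) (simp_all only: diff_Pair)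
      also have "\<dots> \<le> (norm (p i - p j))\<^sup>2"
        using norm_le[of "p i - p j"] by simp
      finally show ?thesis
        by (simp add: power2_le_iff_abs_le)
    qed
    moreover have "Cauchy p"
      by (rule LIMSEQ_imp_Cauchy[OF lim])
    ultimately have "Cauchy u"
      unfolding Cauchy_iff by (meson le_less_trans)
    then obtain k where k: "u \<longlonglongrightarrow> k"
      by (meson Cauchy_convergent convergentD)
    note lim_fst = tendsto_fst[OF lim, simplified] and lim_snd = tendsto_snd[OF lim, simplified]
    have "(f, k) \<in> ?S"
      by (rule nonneg_selfadjoint_closed[OF S, of "\<lambda>n. (fst (p n), u n)"]) (simp_all add: u k lim_fst)
    then have fvS: "(f + v, k + ?S \<cdot> v) \<in> ?S"
      using subspace_add[OF subS _ Sv, of "(f, k)"] by simp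
    then have S_fv: "?S \<cdot> (f + v) = k + ?S \<cdot> v"
      by (rule op_apply_eq[OF svS])
    have AV_fv: "AV \<cdot> (f + v) = y + ?G \<cdot> v"
      by (rule op_apply_eq[OF svAV G_AV[OF fy]])
    \<comment> \<open>Completing the square on the core: <v, V f_n> = <K^(1/2) v, K^(1/2) f_n>, and
      what remains of \<open>Q\<close> is \<open>q v\<close>. The values of \<open>At\<close> have
      dropped out, so both sides converge along the graph of \<open>A\<close>.\<close>
    have "Im (cinner (fst (p n) + v) (snd (p n) + ?G \<cdot> v)) = (norm (u n + ?S \<cdot> v))\<^sup>2 + q v" for n
    proof -
      have "inner (u n) (?S \<cdot> v) = inner v (Vg (snd (p n)) (y' n))"
        using nonneg_selfadjoint_sym[OF S Sv u'[of n]] by (simp add: inner_commute)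
      moreover have "inner (u n) (u n) = inner (fst (p n)) (Vg (snd (p n)) (y' n))"
        using nonneg_selfadjoint_sym[OF S u[of n] u'[of n]] by simp
      ultimately show ?thesis
        unfolding AV_form[OF pA y']
        by (simp add: q_eq[OF v] Q_def power2_norm_eq_inner inner_add_left inner_add_right
            inner_commute[of "?S \<cdot> v" "u n"])
    qed
    moreover have "(\<lambda>n. Im (cinner (fst (p n) + v) (snd (p n) + ?G \<cdot> v)))
        \<longlonglongrightarrow> Im (cinner (f + v) (y + ?G \<cdot> v))"
      unfolding Im_cinner_eq_inner
      by (intro tendsto_intros bounded_linear.tendsto[OF bounded_linear_scaleC] lim_fst lim_snd)
    moreover have "(\<lambda>n. (norm (u n + ?S \<cdot> v))\<^sup>2 + q v) \<longlonglongrightarrow> (norm (k + ?S \<cdot> v))\<^sup>2 + q v"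
      by (intro tendsto_intros k)
    ultimately have "Im (cinner (f + v) (y + ?G \<cdot> v)) = (norm (k + ?S \<cdot> v))\<^sup>2 + q v"
      using LIMSEQ_unique by simp
    moreover have "0 \<le> q v"
      using v_le by (simp add: q_eq[OF v] Q_def)
    ultimately show "f + v \<in> Domain ?S \<and>
        Im (cinner (f + v) (AV \<cdot> (f + v))) = (norm (?S \<cdot> (f + v)))\<^sup>2 + q v \<and>
        (norm (?S \<cdot> (f + v)))\<^sup>2 \<le> (norm (?S \<cdot> (f + v)))\<^sup>2 + q v"
      using fvS by (auto simp: S_fv AV_fv)
  qed
qed

end
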